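(* For every $k\ge 3$ and every $n\ge 3$, every connected $n$-vertex (not necessarily non-homotopic) $k^+$-real face graph has at most $\frac{k}{k-2}(n-2)$ edges.
   Context: Graphs are finite and have no loops, but may have parallel edges. A drawing on the sphere $\mathbb{S}^2$ maps vertices to pairwise distinct points and each edge to a simple Jordan arc joining its endpoints, such that no edge passes through a vertex, any two edges have finitely many common points, every common interior point of two edges is a proper crossing, and no three edges pass through the same crossing. Cells are the connected components of $\mathbb{S}^2$ minus the drawing; a vertex-incidence of a cell is an appearance of a vertex on its boundary (counted with repetitions). A drawing is $k^+$-real face if every cell has at least $k$ vertex-incidences, and a $k^+$-real face graph is a graph admitting such a drawing. *)

theory Defs
  imports "HOL-Analysis.Analysis"
begin

definition multigraph :: "'v set \<Rightarrow> 'e set \<Rightarrow> ('e \<Rightarrow> 'v set) \<Rightarrow> bool" where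
  "multigraph V E ends \<longleftrightarrow> finite V \<and> finite E \<and>
     (\<forall>e\<in>E. ends e \<subseteq> V \<and> card (ends e) = 2)"

definition adjacent :: "'e set \<Rightarrow> ('e \<Rightarrow> 'v set) \<Rightarrow> 'v \<Rightarrow> 'v \<Rightarrow> bool" where
  "adjacent E ends u v \<longleftrightarrow> (\<exists>e\<in>E. ends e = {u, v})"

definition graph_connected :: "'v set \<Rightarrow> 'e set \<Rightarrow> ('e \<Rightarrow> 'v set) \<Rightarrow> bool" where
  "graph_connected V E ends \<longleftrightarrow> V \<noteq> {} \<and>
     (\<forall>u\<in>V. \<forall>v\<in>V. (adjacent E ends)\<^sup>*\<^sup>* u v)"

abbreviation S2 :: "(real^3) set" where
  "S2 \<equiv> sphere 0 1"

definition interior_pts :: "(real \<Rightarrow> real^3) \<Rightarrow> (real^3) set" where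
  "interior_pts g = g ` {0<..<1}"

definition proper_crossing :: "(real \<Rightarrow> real^3) \<Rightarrow> (real \<Rightarrow> real^3) \<Rightarrow> real^3 \<Rightarrow> bool" where
  "proper_crossing g h p \<longleftrightarrow>
     (\<exists>U \<phi> \<psi>. openin (top_of_set S2) U \<and> p \<in> U \<and>
        homeomorphism U (ball (0::complex) 1) \<phi> \<psi> \<and> \<phi> p = 0 \<and>
        \<phi> ` (U \<inter> path_image g) = {z \<in> ball 0 1. Im z = 0} \<and>
        \<phi> ` (U \<inter> path_image h) = {z \<in> ball 0 1. Re z = 0})"

definition drawing ::
  "'v set \<Rightarrow> 'e set \<Rightarrow> ('e \<Rightarrow> 'v set) \<Rightarrow> ('v \<Rightarrow> real^3) \<Rightarrow> ('e \<Rightarrow> real \<Rightarrow> real^3) \<Rightarrow> bool" where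
  "drawing V E ends pos \<gamma> \<longleftrightarrow>
     inj_on pos V \<and> pos ` V \<subseteq> S2 \<and>
     (\<forall>e\<in>E. arc (\<gamma> e) \<and> path_image (\<gamma> e) \<subseteq> S2 \<and>
              {pathstart (\<gamma> e), pathfinish (\<gamma> e)} = pos ` ends e) \<and>
     (\<forall>e\<in>E. interior_pts (\<gamma> e) \<inter> pos ` V = {}) \<and>
     (\<forall>e\<in>E. \<forall>f\<in>E. e \<noteq> f \<longrightarrow> finite (path_image (\<gamma> e) \<inter> path_image (\<gamma> f))) \<and>
     (\<forall>e\<in>E. \<forall>f\<in>E. e \<noteq> f \<longrightarrow>
        (\<forall>p \<in> interior_pts (\<gamma> e) \<inter> interior_pts (\<gamma> f). proper_crossing (\<gamma> e) (\<gamma> f) p)) \<and>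
     (\<forall>e\<in>E. \<forall>f\<in>E. \<forall>g\<in>E. e \<noteq> f \<and> e \<noteq> g \<and> f \<noteq> g \<longrightarrow>
        path_image (\<gamma> e) \<inter> path_image (\<gamma> f) \<inter> path_image (\<gamma> g) \<subseteq> pos ` V)"

definition drawing_set :: "'v set \<Rightarrow> 'e set \<Rightarrow> ('v \<Rightarrow> real^3) \<Rightarrow> ('e \<Rightarrow> real \<Rightarrow> real^3) \<Rightarrow> (real^3) set" where
  "drawing_set V E pos \<gamma> = pos ` V \<union> (\<Union>e\<in>E. path_image (\<gamma> e))"

definition cells :: "'v set \<Rightarrow> 'e set \<Rightarrow> ('v \<Rightarrow> real^3) \<Rightarrow> ('e \<Rightarrow> real \<Rightarrow> real^3) \<Rightarrow> (real^3) set set" where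
  "cells V E pos \<gamma> = components (S2 - drawing_set V E pos \<gamma>)"

text \<open>Appearances of vertex v on the boundary of cell c, counted with repetitions, seen at
  scale eps: the number of components of (small spherical cap around v) minus the drawing
  which lie in c and have v in their closure (the corners of c at v).\<close>

definition corners_at ::
  "'v set \<Rightarrow> 'e set \<Rightarrow> ('v \<Rightarrow> real^3) \<Rightarrow> ('e \<Rightarrow> real \<Rightarrow> real^3) \<Rightarrow> (real^3) set \<Rightarrow> 'v \<Rightarrow> real \<Rightarrow> nat" where
  "corners_at V E pos \<gamma> c v \<epsilon> =
     card {K \<in> components ((S2 \<inter> ball (pos v) \<epsilon>) - drawing_set V E pos \<gamma>).
             K \<subseteq> c \<and> pos v \<in> closure K}"

definition vertex_incidences ::
  "'v set \<Rightarrow> 'e set \<Rightarrow> ('v \<Rightarrow> real^3) \<Rightarrow> ('e \<Rightarrow> real \<Rightarrow> real^3) \<Rightarrow> (real^3) set \<Rightarrow> real \<Rightarrow> nat" where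
  "vertex_incidences V E pos \<gamma> c \<epsilon> = (\<Sum>v\<in>V. corners_at V E pos \<gamma> c v \<epsilon>)"

definition kplus_real_face_drawing ::
  "nat \<Rightarrow> 'v set \<Rightarrow> 'e set \<Rightarrow> ('e \<Rightarrow> 'v set) \<Rightarrow> ('v \<Rightarrow> real^3) \<Rightarrow> ('e \<Rightarrow> real \<Rightarrow> real^3) \<Rightarrow> bool" where
  "kplus_real_face_drawing k V E ends pos \<gamma> \<longleftrightarrow>
     drawing V E ends pos \<gamma> \<and>
     (\<forall>c \<in> cells V E pos \<gamma>.
        eventually (\<lambda>\<epsilon>. k \<le> vertex_incidences V E pos \<gamma> c \<epsilon>) (at_right 0))"

definition kplus_real_face_graph :: "nat \<Rightarrow> 'v set \<Rightarrow> 'e set \<Rightarrow> ('e \<Rightarrow> 'v set) \<Rightarrow> bool" where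
  "kplus_real_face_graph k V E ends \<longleftrightarrow>
     multigraph V E ends \<and> (\<exists>pos \<gamma>. kplus_real_face_drawing k V E ends pos \<gamma>)"

end

theory Submission
  imports Defs
begin

text \<open>Let \<open>m\<close> be the number of edges. Adding the edges one by one so that the drawing stays
  connected, every edge that does not reach a new vertex splits a component of the complement, so
  there are at least \<open>m - n + 2\<close> cells. Around a vertex the drawing consists of \<open>deg v\<close> arcs up to
  their first exit from a small cap, and these cut the cap into at most \<open>deg v\<close> pieces near the
  vertex, so there are at most \<open>2 m\<close> vertex-incidences. Hence \<open>k (m - n + 2) \<le> 2 m\<close>; crossings
  only create more cells and can be ignored.

  Since the arcs may be wild, both counts rest on continuous logarithms. An arc joining two points
  \<open>p\<close>, \<open>q\<close> of a closed set splits at most one component, and into at most two parts, because maps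
  from the twice punctured sphere to the punctured plane are classified by an integer; it does split
  one if the set is path-connected, because \<open>(z - p) / (z - q)\<close> has no logarithm.\<close>

section \<open>Gluing locally constant functions\<close>

text \<open>Logarithms enter through a duality. An integer-valued \<open>\<xi>\<close>, locally
  constant off \<open>S \<union> T\<close>, may jump across both sets, yet \<open>glue_map\<close>
  turns it into a map to the punctured plane that is continuous off the smaller set
  \<open>S \<inter> T\<close>. A logarithm of that map forces \<open>\<xi>\<close> to agree at
  points that can be joined within common connected sets off \<open>S\<close> and off
  \<open>T\<close>. So separation is governed by maps on the complement of
  \<open>S \<inter> T\<close>, which in the applications is a cap, or the sphere without one or two
  points; the wildness of the arcs never shows. Nothing is known in advance about the number of
  components: a wild edge may return to a cap around its end infinitely often and cut it into
  infinitely many pieces, of which only those adherent to the vertex count as corners. Components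
  are therefore counted by finite sets of points in different components. The lower bound exhibits
  one such set and the upper bound applies to all of them, so two inequalities replace Euler's
  formula.\<close>

lemma exp_logs_differ_by_constant:
  fixes g h :: "'a::topological_space \<Rightarrow> complex"
  assumes C: "connected C" and g: "continuous_on C g" and h: "continuous_on C h"
    and eq: "\<And>x. x \<in> C \<Longrightarrow> exp (g x) = exp (h x)" and xy: "x \<in> C" "y \<in> C"
  shows "g x - h x = g y - h y"
proof -
  have "(\<lambda>x. g x - h x) constant_on C"
  proof (rule continuous_discrete_range_constant[OF C])
    show "continuous_on C (\<lambda>x. g x - h x)" by (intro continuous_intros g h)
    fix x assume x: "x \<in> C"
    show "\<exists>e>0. \<forall>y. y \<in> C \<and> g y - h y \<noteq> g x - h x \<longrightarrow> e \<le> norm (g y - h y - (g x - h x))"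
    \<comment> \<open>Two logarithms of one number differ by an integer multiple of 2 pi i, so
      distinct values of the difference are at least 2 pi apart.\<close>
    proof (intro exI[of _ "2*pi"] conjI allI impI)
      fix y assume y: "y \<in> C \<and> g y - h y \<noteq> g x - h x"
      obtain m n :: int where mn: "g x = h x + (of_int (2 * m) * pi) * \<i>" "g y = h y + (of_int (2 * n) * pi) * \<i>"
        using eq[of x] eq[of y] x y unfolding exp_eq by blast
      have e: "g y - h y - (g x - h x) = of_real (2 * (real_of_int (n - m)) * pi) * \<i>"
        unfolding mn by (simp add: algebra_simps)
      then have "n \<noteq> m" using y by auto
      then have "1 \<le> \<bar>real_of_int (n - m)\<bar>" by linarith
      then have "2 * pi * 1 \<le> 2 * pi * \<bar>real_of_int (n - m)\<bar>" by (intro mult_left_mono) auto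
      then show "2 * pi \<le> norm (g y - h y - (g x - h x))"
        unfolding e norm_mult norm_of_real norm_ii abs_mult by (simp add: mult_ac)
    qed simp
  qed
  then show ?thesis using xy by (auto simp: constant_on_def)
qed

text \<open>At points of \<open>T\<close> the factor \<open>f\<close> tends to 0 and
  \<open>h\<close> is bounded, so the product tends to 0 however \<open>h\<close> jumps there; every
  other point has a neighbourhood off the closed set \<open>T\<close>. This absorbs the jumps of an
  indicator function.\<close>

lemma continuous_on_mult_vanishing:
  fixes f h :: "'a::metric_space \<Rightarrow> real"
  assumes f: "continuous_on U f" and T: "closed T" and f0: "\<And>x. x \<in> U \<inter> T \<Longrightarrow> f x = 0"
    and h: "continuous_on (U - T) h" and B: "\<And>x. \<bar>h x\<bar> \<le> B"
  shows "continuous_on U (\<lambda>x. f x * h x)"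
  unfolding continuous_on_eq_continuous_within
proof
  fix x assume x: "x \<in> U"
  have fx: "(f \<longlongrightarrow> f x) (at x within U)" using f x by (auto simp: continuous_on)
  show "continuous (at x within U) (\<lambda>x. f x * h x)"
  proof (cases "x \<in> T")
    case True
    have fx0: "(f \<longlongrightarrow> 0) (at x within U)" using fx f0[of x] x True by simp
    have "((\<lambda>x. f x * h x) \<longlongrightarrow> 0) (at x within U)"
    proof (rule Lim_null_comparison)
      show "eventually (\<lambda>x. norm (f x * h x) \<le> \<bar>f x\<bar> * B) (at x within U)"
        by (intro always_eventually allI) (auto simp: abs_mult intro!: mult_left_mono B)
      show "((\<lambda>x. \<bar>f x\<bar> * B) \<longlongrightarrow> 0) (at x within U)"
        using tendsto_mult_left_zero[OF tendsto_rabs_zero[OF fx0]] by simp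
    qed
    then show ?thesis using f0[of x] x True by (simp add: continuous_within)
  next
    case False
    have "at x within U = at x within (U - T)"
      using False T by (intro at_within_nhd[of x "-T"]) auto
    moreover have "continuous (at x within (U - T)) (\<lambda>x. f x * h x)"
      using continuous_on_mult[OF continuous_on_subset[OF f, of "U - T"] h] x False
      by (auto simp: continuous_on_eq_continuous_within)
    ultimately show ?thesis by simp
  qed
qed

text \<open>A Urysohn function: away from \<open>S \<inter> T\<close> it is 1 on \<open>S\<close>
  and 0 on \<open>T\<close>, for closed nonempty sets.\<close>

definition glue_weight :: "'a::metric_space set \<Rightarrow> 'a set \<Rightarrow> 'a \<Rightarrow> real" where
  "glue_weight S T x = infdist x T / (infdist x S + infdist x T)"

text \<open>The values of \<open>\<xi>\<close> on \<open>S \<union> T\<close> do not matter: off \<open>S \<inter> T\<close> the weight is 0 or 1 there.\<close>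

definition glue_map :: "'a::metric_space set \<Rightarrow> 'a set \<Rightarrow> ('a \<Rightarrow> int) \<Rightarrow> 'a \<Rightarrow> complex" where
  "glue_map S T \<xi> x = exp (of_real (2 * pi * (glue_weight S T x * of_int (\<xi> x))) * \<i>)"

lemma infdist_sum_pos:
  assumes "closed S" "closed T" "S \<noteq> {}" "T \<noteq> {}" "x \<notin> S \<inter> T"
  shows "infdist x S + infdist x T > 0"
  using assms infdist_pos_not_in_closed[of S x] infdist_pos_not_in_closed[of T x]
    infdist_nonneg[of x S] infdist_nonneg[of x T] by force

text \<open>The weights \<open>w\<close> and \<open>w - 1\<close> define the same map to the
  punctured plane, which thus has two lifts: one is continuous across \<open>T\<close>, the other
  across \<open>S\<close>.\<close>

lemma exp_2pi_of_int_shift: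
  "exp (of_real (2 * pi * ((w - 1) * real_of_int n)) * \<i>) = exp (of_real (2 * pi * (w * real_of_int n)) * \<i>)"
  unfolding exp_eq by (rule exI[of _ "-n"]) (simp add: algebra_simps)

context
  fixes M S T :: "'a::metric_space set" and \<xi> :: "'a \<Rightarrow> int" and B :: real
  assumes S: "closed S" "S \<noteq> {}" and T: "closed T" "T \<noteq> {}"
    and chi: "continuous_on (M - (S \<union> T)) (\<lambda>x. real_of_int (\<xi> x))"
    and B: "\<And>x. \<bar>real_of_int (\<xi> x)\<bar> \<le> B"
begin

lemma continuous_on_glue_weight: "continuous_on (M - S \<inter> T) (glue_weight S T)"
  unfolding glue_weight_def
  using infdist_sum_pos[OF S(1) T(1) S(2) T(2)] by (intro continuous_intros) fastforce

text \<open>Off \<open>S\<close> the jumps of \<open>\<xi>\<close> lie on \<open>T\<close>, where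
  the weight is 0. The next lemma is the mirror image: off \<open>T\<close> they lie on
  \<open>S\<close>, where the weight minus 1 is 0.\<close>

lemma continuous_on_glue_lift_off_S: "continuous_on (M - S) (\<lambda>x. glue_weight S T x * of_int (\<xi> x))"
proof (rule continuous_on_mult_vanishing[OF _ T(1) _ _ B])
  show "continuous_on (M - S) (glue_weight S T)"
    by (rule continuous_on_subset[OF continuous_on_glue_weight]) auto
  show "continuous_on (M - S - T) (\<lambda>x. real_of_int (\<xi> x))"
    using chi by (simp add: Diff_eq Int_assoc)
qed (use T in \<open>auto simp: glue_weight_def\<close>)

lemma continuous_on_glue_lift_off_T: "continuous_on (M - T) (\<lambda>x. (glue_weight S T x - 1) * of_int (\<xi> x))"
proof (rule continuous_on_mult_vanishing[OF _ S(1) _ _ B])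
  show "continuous_on (M - T) (\<lambda>x. glue_weight S T x - 1)"
    by (intro continuous_intros continuous_on_subset[OF continuous_on_glue_weight]) auto
  show "continuous_on (M - T - S) (\<lambda>x. real_of_int (\<xi> x))"
    using chi by (simp add: Diff_eq Int_ac)
  show "glue_weight S T x - 1 = 0" if "x \<in> (M - T) \<inter> S" for x
    using that infdist_pos_not_in_closed[OF T, of x] by (auto simp: glue_weight_def)
qed

text \<open>\<open>M - S\<close> and \<open>M - T\<close> form an open cover, and on each of them
  the map is the exponential of a continuous lift.\<close>

lemma continuous_on_glue_map: "continuous_on (M - S \<inter> T) (glue_map S T \<xi>)"
proof -
  have 1: "continuous_on (M - S) (glue_map S T \<xi>)"
    unfolding glue_map_def by (intro continuous_intros continuous_on_glue_lift_off_S)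
  have "continuous_on (M - T) (\<lambda>x. exp (of_real (2 * pi * ((glue_weight S T x - 1) * of_int (\<xi> x))) * \<i>))"
    by (intro continuous_intros continuous_on_glue_lift_off_T)
  then have 2: "continuous_on (M - T) (glue_map S T \<xi>)"
    unfolding exp_2pi_of_int_shift glue_map_def .
  have eq: "M - S \<inter> T = (M - S) \<union> (M - T)" by auto
  have o: "openin (top_of_set ((M - S) \<union> (M - T))) (M - S)" "openin (top_of_set ((M - S) \<union> (M - T))) (M - T)"
    using S T by (auto simp: openin_open intro: exI[of _ "-S"] exI[of _ "-T"])
  show ?thesis unfolding eq using continuous_on_Un_local_open[OF o] 1 2 by blast
qed

text \<open>Exactness of the Mayer--Vietoris sequence at the connecting homomorphism, with integral
  1-cocycles represented by maps into the punctured plane.\<close>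

lemma glue_log_imp_constant:
  assumes G: "continuous_on (M - S \<inter> T) G" "\<And>x. x \<in> M - S \<inter> T \<Longrightarrow> glue_map S T \<xi> x = exp (G x)"
    and C1: "connected C1" "C1 \<subseteq> M - S" and C2: "connected C2" "C2 \<subseteq> M - T"
    and xy: "x \<in> C1 \<inter> C2" "y \<in> C1 \<inter> C2"
  shows "\<xi> x = \<xi> y"
proof -
  let ?w = "glue_weight S T"
  let ?g1 = "\<lambda>x. of_real (2 * pi * (?w x * of_int (\<xi> x))) * \<i>"
  let ?g2 = "\<lambda>x. of_real (2 * pi * ((?w x - 1) * of_int (\<xi> x))) * \<i>"
  \<comment> \<open>\<open>G\<close> differs from the first lift by a constant on \<open>C1\<close>
    and from the second by a constant on \<open>C2\<close>, while the two lifts differ from each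
    other by 2 pi i \<open>\<xi>\<close>.\<close>
  have "G x - ?g1 x = G y - ?g1 y"
  proof (rule exp_logs_differ_by_constant[OF C1(1)])
    show "continuous_on C1 G" using G(1) C1(2) by (auto intro: continuous_on_subset)
    show "continuous_on C1 ?g1"
      by (intro continuous_intros continuous_on_subset[OF continuous_on_glue_lift_off_S C1(2)])
    show "exp (G z) = exp (?g1 z)" if "z \<in> C1" for z
      using G(2)[of z] C1(2) that by (auto simp: glue_map_def)
  qed (use xy in auto)
  moreover have "G x - ?g2 x = G y - ?g2 y"
  proof (rule exp_logs_differ_by_constant[OF C2(1)])
    show "continuous_on C2 G" using G(1) C2(2) by (auto intro: continuous_on_subset)
    show "continuous_on C2 ?g2"
      by (intro continuous_intros continuous_on_subset[OF continuous_on_glue_lift_off_T C2(2)])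
    show "exp (G z) = exp (?g2 z)" if "z \<in> C2" for z
      unfolding exp_2pi_of_int_shift using G(2)[of z] C2(2) that by (auto simp: glue_map_def)
  qed (use xy in auto)
  moreover have "u1 - u2 = v1 - v2" if "U - u1 = V - v1" "U - u2 = V - v2" for U V u1 u2 v1 v2 :: complex
    using that by algebra
  ultimately have "?g1 x - ?g2 x = ?g1 y - ?g2 y" by blast
  then have "complex_of_real (2 * pi * real_of_int (\<xi> x)) * \<i> = of_real (2 * pi * real_of_int (\<xi> y)) * \<i>"
    by (simp add: algebra_simps)
  then have "complex_of_real (2 * pi * real_of_int (\<xi> x)) = of_real (2 * pi * real_of_int (\<xi> y))"
    by (metis complex_i_not_zero mult_right_cancel)
  then have "2 * pi * real_of_int (\<xi> x) = 2 * pi * real_of_int (\<xi> y)"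
    unfolding of_real_eq_iff .
  then show ?thesis by simp
qed

end

section \<open>Separation of the sphere: upper bounds\<close>

text \<open>Components of a locally connected set are relatively open, so it is enough that the
  function is constant on each of them.\<close>

lemma continuous_on_component_indicator:
  fixes U :: "'a::real_normed_vector set"
  assumes "locally connected U"
  shows "continuous_on U (\<lambda>x. real_of_int (if x \<in> connected_component_set U a then 1 else 0))"
proof (rule continuous_on_components[OF assms])
  fix c assume "c \<in> components U"
  then have "c \<subseteq> connected_component_set U a \<or> c \<inter> connected_component_set U a = {}"
    by (metis components_iff connected_component_disjoint connected_component_eq order_refl disjoint_iff)
  then show "continuous_on c (\<lambda>x. real_of_int (if x \<in> connected_component_set U a then 1 else 0))"
  proof
    assume "c \<subseteq> connected_component_set U a"
    then show ?thesis by (intro continuous_on_eq[OF continuous_on_const[of c 1]]) auto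
  next
    assume "c \<inter> connected_component_set U a = {}"
    then show ?thesis by (intro continuous_on_eq[OF continuous_on_const[of c 0]]) auto
  qed
qed

lemma locally_connected_Diff_closed:
  assumes "locally connected M" "closed S"
  shows "locally connected (M - S)"
  using locally_open_subset[OF assms(1)] assms(2)
  by (metis Diff_eq open_Compl openin_open_Int)

text \<open>Janiszewski's theorem, with the usual connectedness of \<open>S \<inter> T\<close>
  replaced by the existence of logarithms off \<open>S \<inter> T\<close>. For the indicator of the
  component of \<open>a\<close>, the logarithm forces the value 1 at \<open>b\<close> as
  well.\<close>

lemma Janiszewski_Borsukian:
  fixes M :: "'a::real_normed_vector set"
  assumes M: "locally connected M" and S: "closed S" "S \<noteq> {}" and T: "closed T" "T \<noteq> {}"
    and Bor: "Borsukian (M - S \<inter> T)"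
    and ab: "connected_component (M - S) a b" "connected_component (M - T) a b"
  shows "connected_component (M - (S \<union> T)) a b"
proof (rule ccontr)
  assume nc: "\<not> connected_component (M - (S \<union> T)) a b"
  let ?U = "M - (S \<union> T)"
  define \<xi> :: "'a \<Rightarrow> int" where "\<xi> x = (if x \<in> connected_component_set ?U a then 1 else 0)" for x
  have lc: "locally connected ?U" using M S T by (intro locally_connected_Diff_closed) auto
  have cont: "continuous_on ?U (\<lambda>x. real_of_int (\<xi> x))"
    unfolding \<xi>_def using continuous_on_component_indicator[OF lc] .
  have B: "\<bar>real_of_int (\<xi> x)\<bar> \<le> 1" for x by (simp add: \<xi>_def)
  have "\<exists>G. continuous_on (M - S \<inter> T) G \<and> (\<forall>x \<in> M - S \<inter> T. glue_map S T \<xi> x = exp (G x))"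
    using Bor continuous_on_glue_map[OF S T cont B] unfolding Borsukian_continuous_logarithm
    by (auto simp: glue_map_def)
  then obtain G where G: "continuous_on (M - S \<inter> T) G" "\<And>x. x \<in> M - S \<inter> T \<Longrightarrow> glue_map S T \<xi> x = exp (G x)"
    by blast
  have "\<xi> a = \<xi> b"
  proof (rule glue_log_imp_constant[OF S T cont B G])
    show "connected (connected_component_set (M - S) a)" "connected (connected_component_set (M - T) a)"
      by auto
    show "connected_component_set (M - S) a \<subseteq> M - S" "connected_component_set (M - T) a \<subseteq> M - T"
      by (rule connected_component_subset)+
    show "a \<in> connected_component_set (M - S) a \<inter> connected_component_set (M - T) a"
      using ab[THEN connected_component_in] by auto
  qed (use ab in auto)
  moreover have "a \<in> ?U" using ab[THEN connected_component_in] by auto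
  ultimately show False using nc by (simp add: \<xi>_def split: if_splits)
qed

section \<open>Maps from the twice punctured sphere to the punctured plane\<close>

text \<open>Pulled back along the exponential, the map has a logarithm \<open>L\<close> on the whole
  plane. Over one period \<open>L\<close> grows by a fixed amount 2 pi i \<open>N\<close>;
  subtracting \<open>N\<close> times the variable leaves a periodic function, which descends to the
  punctured plane.\<close>

lemma punctured_plane_map_decomposition:
  assumes f: "continuous_on (-{0}) f" and nz: "\<And>z. z \<noteq> 0 \<Longrightarrow> f z \<noteq> (0::complex)"
  obtains N :: int and g where "continuous_on (-{0}) g" "\<And>z. z \<noteq> 0 \<Longrightarrow> f z = z powi N * exp (g z)"
proof -
  have "continuous_on UNIV (f \<circ> exp)"
    by (intro continuous_on_compose continuous_intros continuous_on_subset[OF f]) auto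
  moreover have "(f \<circ> exp) \<in> UNIV \<rightarrow> - {0}" using nz by auto
  ultimately have "\<exists>L. continuous_on UNIV L \<and> (\<forall>w\<in>UNIV. (f \<circ> exp) w = exp (L w))"
    using Borsukian_UNIV[where 'a=complex] unfolding Borsukian_continuous_logarithm by blast
  then obtain L where L: "continuous_on UNIV L" and fL: "\<And>w. f (exp w) = exp (L w)"
    by auto
  let ?p = "2 * of_real pi * \<i> :: complex"
  have per: "exp (w + ?p) = exp w" for w by (simp add: exp_add)
  obtain N :: int where N: "L ?p = L 0 + (of_int (2 * N) * pi) * \<i>"
    using fL[of ?p] fL[of 0] per[of 0] exp_eq[of "L ?p" "L 0"] by auto
  define Q where "Q w = L w - of_int N * w" for w
  have shift: "L (w + ?p) - L w = of_int N * ?p" for w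
  proof -
    \<comment> \<open>\<open>L\<close> and its translate are logarithms of the same function, so the
      increment does not depend on \<open>w\<close>.\<close>
    have "L (w + ?p) - L w = L (0 + ?p) - L 0"
      by (rule exp_logs_differ_by_constant[where C=UNIV])
        (auto simp: fL[symmetric] per intro!: L continuous_on_compose2[OF L] continuous_intros)
    then show ?thesis using N by simp
  qed
  interpret Q: periodic_fun_simple Q ?p
    by standard (use shift in \<open>simp add: Q_def algebra_simps\<close>)
  have Qexp: "Q w = Q w'" if ee: "exp w = exp w'" for w w'
  proof -
    obtain n :: int where "w = w' + (of_int (2 * n) * pi) * \<i>" using ee unfolding exp_eq by blast
    then have "w = w' + of_int n * ?p" by simp
    then show ?thesis using Q.plus_of_int by metis
  qed
  have Qc: "isCont Q w" for w
    unfolding Q_def using L by (auto intro!: continuous_intros simp: continuous_on_eq_continuous_at)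
  have "isCont (\<lambda>z. Q (Ln z)) z0" if z0: "z0 \<noteq> 0" for z0
  proof -
    \<comment> \<open>A branch of the logarithm whose cut misses \<open>z0\<close>; since
      \<open>Q\<close> is periodic, the choice of the branch does not change the value.\<close>
    let ?l = "\<lambda>z. Ln (z / z0) + Ln z0"
    have "isCont (\<lambda>z. Q (?l z)) z0"
      using z0 by (intro isCont_o2[OF _ Qc]) (auto intro!: continuous_intros simp: complex_nonpos_Reals_iff)
    moreover have "eventually (\<lambda>z. z \<noteq> 0) (nhds z0)"
      using z0 by (simp add: t1_space_nhds)
    then have "eventually (\<lambda>z. Q (?l z) = Q (Ln z)) (nhds z0)"
      by eventually_elim (use z0 in \<open>auto intro!: Qexp simp: exp_add\<close>)
    ultimately show ?thesis using isCont_cong by fast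
  qed
  then have "continuous_on (-{0}) (\<lambda>z. Q (Ln z))"
    by (simp add: continuous_at_imp_continuous_on)
  moreover have "f z = z powi N * exp (Q (Ln z))" if "z \<noteq> 0" for z
  proof -
    have "f z = exp (L (Ln z))" using fL[of "Ln z"] that by simp
    also have "\<dots> = exp (of_int N * Ln z) * exp (Q (Ln z))" by (simp add: Q_def flip: exp_add)
    also have "exp (of_int N * Ln z) = z powi N" using that by (simp flip: exp_power_int)
    finally show ?thesis .
  qed
  ultimately show thesis using that by blast
qed

lemma punctured_S2_homeomorphic_complex:
  assumes "q \<in> S2"
  shows "(S2 - {q}) homeomorphic (UNIV :: complex set)"
  using assms by (intro homeomorphic_punctured_sphere_affine) auto

text \<open>A chart with \<open>q\<close> at infinity, shifted so that \<open>p\<close> goes to 0.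
  The coordinate \<open>h\<close> is quantified before \<open>f\<close>, so that the exponents
  \<open>N\<close> of different maps refer to one coordinate and can be combined.\<close>

lemma twice_punctured_S2_map_decomposition:
  assumes "p \<in> S2" "q \<in> S2" "p \<noteq> q"
  shows "\<exists>h :: real^3 \<Rightarrow> complex. (\<forall>x\<in>S2 - {p,q}. h x \<noteq> 0) \<and>
    (\<forall>f. continuous_on (S2 - {p,q}) f \<and> (\<forall>x\<in>S2 - {p,q}. f x \<noteq> 0) \<longrightarrow>
      (\<exists>(N::int) g. continuous_on (S2 - {p,q}) g \<and> (\<forall>x\<in>S2 - {p,q}. f x = h x powi N * exp (g x))))"
proof -
  obtain j k where jk: "homeomorphism (S2 - {q}) (UNIV :: complex set) j k"
    using punctured_S2_homeomorphic_complex[OF assms(2)] unfolding homeomorphic_def by blast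
  define h where "h x = j x - j p" for x
  define i where "i z = k (z + j p)" for z
  have kj: "k (j x) = x" if "x \<in> S2 - {q}" for x using jk that by (auto simp: homeomorphism_def)
  have jk': "j (k z) = z" for z using jk by (auto simp: homeomorphism_def)
  have kr: "k z \<in> S2 - {q}" for z using homeomorphism_image2[OF jk] by blast
  have hn: "h x \<noteq> 0" if "x \<in> S2 - {p,q}" for x
    using that kj[of x] kj[of p] assms by (auto simp: h_def)
  have hi: "h ` (S2 - {p,q}) \<subseteq> - {0}"
  proof
    fix y assume "y \<in> h ` (S2 - {p,q})"
    then obtain x where "y = h x" "x \<in> S2 - {p,q}" by (rule imageE)
    then show "y \<in> - {0}" using hn[of x] by simp
  qed
  have hc: "continuous_on (S2 - {p,q}) h"
    unfolding h_def using jk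
    by (intro continuous_intros continuous_on_subset[OF homeomorphism_cont1[OF jk]]) auto
  have ic: "continuous_on (-{0}) i"
    unfolding i_def by (intro continuous_on_compose2[OF homeomorphism_cont2[OF jk]] continuous_intros) auto
  have ir: "i z \<in> S2 - {p,q}" if "z \<noteq> 0" for z
    using kr[of "z + j p"] jk'[of "z + j p"] that by (auto simp: i_def)
  have ih: "i (h x) = x" if "x \<in> S2 - {p,q}" for x using that kj by (simp add: i_def h_def)
  show ?thesis
  proof (intro exI[of _ h] conjI ballI allI impI)
    fix f :: "real^3 \<Rightarrow> complex" assume "continuous_on (S2 - {p,q}) f \<and> (\<forall>x\<in>S2 - {p,q}. f x \<noteq> 0)"
    then have f: "continuous_on (S2 - {p,q}) f" "\<And>x. x \<in> S2 - {p,q} \<Longrightarrow> f x \<noteq> 0" by blast+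
    have "continuous_on (-{0}) (\<lambda>z. f (i z))"
      using ir by (intro continuous_on_compose2[OF f(1) ic]) auto
    then obtain N :: int and g where g: "continuous_on (-{0}) g" "\<And>z. z \<noteq> 0 \<Longrightarrow> f (i z) = z powi N * exp (g z)"
      by (rule punctured_plane_map_decomposition) (use f(2) ir in auto)
    have "continuous_on (S2 - {p,q}) (\<lambda>x. g (h x))"
      by (rule continuous_on_compose2[OF g(1) hc hi])
    moreover have "f x = h x powi N * exp (g (h x))" if "x \<in> S2 - {p,q}" for x
      using g(2)[OF hn[OF that]] ih[OF that] by simp
    ultimately show "\<exists>(N::int) g. continuous_on (S2 - {p,q}) g \<and> (\<forall>x\<in>S2 - {p,q}. f x = h x powi N * exp (g x))"
      by (intro exI[of _ N] exI[of _ "\<lambda>x. g (h x)"]) auto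
  qed (rule hn)
qed

text \<open>Gluing turns sums into products, so winding numbers can be cancelled by an integer
  combination.\<close>

lemma glue_map_lincomb:
  "glue_map S T (\<lambda>x. m * \<xi> x + n * \<eta> x) x = glue_map S T \<xi> x powi m * glue_map S T \<eta> x powi n"
  unfolding glue_map_def exp_power_int exp_add[symmetric]
  by (rule arg_cong[of _ _ exp]) (simp add: algebra_simps)

text \<open>The indicators of the components of \<open>a\<close> and \<open>b\<close> have winding
  numbers \<open>Na\<close> and \<open>Nb\<close> about the punctures. A combination with winding
  number 0 has a logarithm and hence takes one value at \<open>a\<close>, \<open>b\<close> and
  \<open>c\<close>, whereas three different components would give the values \<open>Nb\<close>,
  \<open>- Na\<close> and 0.\<close>

lemma chord_splits_in_at_most_two:
  fixes a b c :: "real^3"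
  assumes S: "closed S" and A: "closed A" and SA: "S \<inter> A = {p,q}" and pq: "p \<noteq> q" "p \<in> S2" "q \<in> S2"
    and conA: "connected (S2 - A)"
    and abc: "a \<in> S2 - (S \<union> A)" "b \<in> S2 - (S \<union> A)" "c \<in> S2 - (S \<union> A)"
    and ab: "connected_component (S2 - S) a b" and ac: "connected_component (S2 - S) a c"
  shows "connected_component (S2 - (S \<union> A)) a b \<or> connected_component (S2 - (S \<union> A)) a c \<or>
    connected_component (S2 - (S \<union> A)) b c"
proof (rule ccontr)
  let ?U = "S2 - (S \<union> A)"
  assume "\<not> ?thesis"
  then have nc: "\<not> connected_component ?U a b" "\<not> connected_component ?U a c" "\<not> connected_component ?U b c"
    "\<not> connected_component ?U b a"
    by (auto simp: connected_component_sym_eq)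
  have ne: "S \<noteq> {}" "A \<noteq> {}" using SA by auto
  define \<xi> :: "real^3 \<Rightarrow> real^3 \<Rightarrow> int" where "\<xi> u x = (if x \<in> connected_component_set ?U u then 1 else 0)" for u x
  have lc: "locally connected ?U"
    using S A by (intro locally_connected_Diff_closed locally_connected_sphere) auto
  have cont: "continuous_on ?U (\<lambda>x. real_of_int (\<xi> u x))" for u
    unfolding \<xi>_def using continuous_on_component_indicator[OF lc] .
  have B: "\<bar>real_of_int (\<xi> u x)\<bar> \<le> 1" for u x by (simp add: \<xi>_def)
  have dom: "S2 - S \<inter> A = S2 - {p,q}" using SA by simp
  have const: "\<zeta> x = \<zeta> y"
    if "continuous_on ?U (\<lambda>x. real_of_int (\<zeta> x))" "\<And>x. \<bar>real_of_int (\<zeta> x)\<bar> \<le> D"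
      and "continuous_on (S2 - {p,q}) G" "\<And>x. x \<in> S2 - {p,q} \<Longrightarrow> glue_map S A \<zeta> x = exp (G x)"
      and "x \<in> {a,b,c}" "y \<in> {a,b,c}" for \<zeta> D G x y
  proof (rule glue_log_imp_constant[OF S ne(1) A ne(2) that(1,2), unfolded dom, OF that(3,4)])
    show "connected (connected_component_set (S2 - S) a)" "connected (S2 - A)" using conA by auto
    show "x \<in> connected_component_set (S2 - S) a \<inter> (S2 - A)" "y \<in> connected_component_set (S2 - S) a \<inter> (S2 - A)"
      using that(5,6) abc ab ac by auto
    show "connected_component_set (S2 - S) a \<subseteq> S2 - S" by (rule connected_component_subset)
  qed auto
  obtain h :: "real^3 \<Rightarrow> complex" where h0: "\<forall>x\<in>S2 - {p,q}. h x \<noteq> 0"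
    and dec: "\<forall>f. continuous_on (S2 - {p,q}) f \<and> (\<forall>x\<in>S2 - {p,q}. f x \<noteq> 0) \<longrightarrow>
      (\<exists>(N::int) g. continuous_on (S2 - {p,q}) g \<and> (\<forall>x\<in>S2 - {p,q}. f x = h x powi N * exp (g x)))"
    using twice_punctured_S2_map_decomposition[OF pq(2,3,1)] by (elim exE conjE)
  have ex: "\<exists>(N::int) g. continuous_on (S2 - {p,q}) g \<and> (\<forall>x\<in>S2 - {p,q}. glue_map S A (\<xi> u) x = h x powi N * exp (g x))" for u
    using continuous_on_glue_map[OF S ne(1) A ne(2) cont B]
    by (intro dec[rule_format]) (simp add: dom glue_map_def)
  obtain Na :: int and ga where ga: "continuous_on (S2 - {p,q}) ga"
      "\<And>x. x \<in> S2 - {p,q} \<Longrightarrow> glue_map S A (\<xi> a) x = h x powi Na * exp (ga x)"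
    using ex[of a] by blast
  obtain Nb :: int and gb where gb: "continuous_on (S2 - {p,q}) gb"
      "\<And>x. x \<in> S2 - {p,q} \<Longrightarrow> glue_map S A (\<xi> b) x = h x powi Nb * exp (gb x)"
    using ex[of b] by blast
  \<comment> \<open>The exponents of \<open>h\<close> cancel in this combination, which leaves the
    logarithm \<open>G\<close>.\<close>
  define \<zeta> where "\<zeta> x = Nb * \<xi> a x + (- Na) * \<xi> b x" for x
  define G where "G x = of_int Nb * ga x + of_int (- Na) * gb x" for x
  have z: "\<zeta> x = \<zeta> y" if "x \<in> {a,b,c}" "y \<in> {a,b,c}" for x y
  proof (rule const[OF _ _ _ _ that, where G=G and D="\<bar>real_of_int Nb\<bar> + \<bar>real_of_int Na\<bar>"])
    show "continuous_on ?U (\<lambda>x. real_of_int (\<zeta> x))"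
      unfolding \<zeta>_def of_int_add of_int_mult by (intro continuous_intros cont)
    show "\<bar>real_of_int (\<zeta> x)\<bar> \<le> \<bar>real_of_int Nb\<bar> + \<bar>real_of_int Na\<bar>" for x
      unfolding \<zeta>_def \<xi>_def by auto
    show "continuous_on (S2 - {p,q}) G" unfolding G_def by (intro continuous_intros ga(1) gb(1))
    fix x assume x: "x \<in> S2 - {p,q}"
    have "glue_map S A \<zeta> x = (h x powi Na * exp (ga x)) powi Nb * (h x powi Nb * exp (gb x)) powi (- Na)"
      unfolding \<zeta>_def glue_map_lincomb using ga(2)[OF x] gb(2)[OF x] by simp
    also have "\<dots> = (h x powi (Na * Nb) * h x powi (Nb * (- Na))) * (exp (ga x) powi Nb * exp (gb x) powi (- Na))"
      unfolding power_int_mult_distrib power_int_mult[symmetric] by (simp add: mult_ac)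
    also have "h x powi (Na * Nb) * h x powi (Nb * (- Na)) = 1"
      using bspec[OF h0 x] by (simp add: power_int_add[symmetric] mult.commute)
    also have "exp (ga x) powi Nb * exp (gb x) powi (- Na) = exp (G x)"
      unfolding exp_power_int G_def exp_add[symmetric] by simp
    finally show "glue_map S A \<zeta> x = exp (G x)" by simp
  qed
  have v: "\<xi> a a = 1" "\<xi> a b = 0" "\<xi> a c = 0" "\<xi> b a = 0" "\<xi> b b = 1" "\<xi> b c = 0"
    using nc abc by (auto simp: \<xi>_def)
  have "Na = 0" using z[of a c] z[of b c] v by (simp add: \<zeta>_def)
  \<comment> \<open>With \<open>Na = 0\<close> already the indicator of the component of
    \<open>a\<close> has a logarithm, although it distinguishes \<open>a\<close> from
    \<open>b\<close>.\<close>
  have "\<xi> a a = \<xi> a b"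
  proof (rule const[OF cont B ga(1)])
    show "glue_map S A (\<xi> a) x = exp (ga x)" if "x \<in> S2 - {p,q}" for x
      using ga(2)[OF that] \<open>Na = 0\<close> by simp
  qed simp_all
  then show False using v by simp
qed

section \<open>Caps and arcs on the sphere\<close>

text \<open>The cap is the radial projection of a convex cone that contains it, hence a retract of
  that cone.\<close>

lemma S2_cap_retract_of_convex:
  fixes v :: "real^3"
  assumes v: "v \<in> S2" and e: "0 < \<epsilon>" "\<epsilon> \<le> 1"
  obtains K r where "convex K" "continuous_on K r" "r ` K = S2 \<inter> ball v \<epsilon>" "S2 \<inter> ball v \<epsilon> \<subseteq> K"
    "\<And>x. x \<in> S2 \<inter> ball v \<epsilon> \<Longrightarrow> r x = (x :: real^3)"
proof -
  \<comment> \<open>On the unit sphere the squared distance to \<open>v\<close> is 2 - 2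
    \<open>(v \<bullet> x)\<close>, so the cap is given by \<open>v \<bullet> x > c\<close>. The
    convexity of the cone uses \<open>c \<ge> 0\<close>, which comes from
    \<open>\<epsilon> \<le> 1\<close>.\<close>
  define c where "c = 1 - \<epsilon>\<^sup>2 / 2"
  have "\<epsilon>\<^sup>2 \<le> 1" using e by (simp add: power_le_one)
  then have c: "0 \<le> c" by (simp add: c_def)
  define K where "K = {y. v \<bullet> y > c * norm y}"
  define r where "r = (\<lambda>y::real^3. y /\<^sub>R norm y)"
  have nv: "norm v = 1" using v by simp
  have mem: "x \<in> S2 \<inter> ball v \<epsilon> \<longleftrightarrow> norm x = 1 \<and> v \<bullet> x > c" for x
  proof -
    have "dist v x < \<epsilon> \<longleftrightarrow> (dist v x)\<^sup>2 < \<epsilon>\<^sup>2"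
      using e by (metis less_imp_le power2_less_imp_less power_strict_mono zero_le_dist zero_less_numeral)
    moreover have "(dist v x)\<^sup>2 = 2 - 2 * (v \<bullet> x)" if "norm x = 1"
      using that nv by (simp add: dist_norm power2_norm_eq_inner inner_diff norm_eq_1 inner_commute)
    ultimately show ?thesis by (auto simp: c_def)
  qed
  have K0: "y \<noteq> 0" if "y \<in> K" for y using that by (auto simp: K_def)
  show thesis
  proof (rule that)
    show "convex K"
    proof (rule convexI)
      fix x y :: "real^3" and s t :: real assume a: "x \<in> K" "y \<in> K" "0 \<le> s" "0 \<le> t" "s + t = 1"
      have n: "c * norm (s *\<^sub>R x + t *\<^sub>R y) \<le> s * (c * norm x) + t * (c * norm y)"
      proof -
        have "norm (s *\<^sub>R x + t *\<^sub>R y) \<le> s * norm x + t * norm y"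
          using norm_triangle_ineq[of "s *\<^sub>R x" "t *\<^sub>R y"] a by simp
        then have "c * norm (s *\<^sub>R x + t *\<^sub>R y) \<le> c * (s * norm x + t * norm y)"
          using c by (rule mult_left_mono)
        then show ?thesis by (simp add: algebra_simps)
      qed
      have "s * (c * norm x) + t * (c * norm y) < s * (v \<bullet> x) + t * (v \<bullet> y)"
      proof (cases "s = 0")
        case True
        then show ?thesis using a by (simp add: K_def)
      next
        case False
        then have "s * (c * norm x) < s * (v \<bullet> x)" using a by (simp add: K_def)
        moreover have "t * (c * norm y) \<le> t * (v \<bullet> y)" using a by (intro mult_left_mono) (auto simp: K_def)
        ultimately show ?thesis by simp
      qed
      then show "s *\<^sub>R x + t *\<^sub>R y \<in> K" using n by (simp add: K_def inner_add_right)
    qed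
    show "continuous_on K r" unfolding r_def using K0 by (intro continuous_intros) auto
    have sub: "S2 \<inter> ball v \<epsilon> \<subseteq> K"
    proof
      fix x assume "x \<in> S2 \<inter> ball v \<epsilon>"
      then show "x \<in> K" unfolding mem by (simp add: K_def)
    qed
    then show "S2 \<inter> ball v \<epsilon> \<subseteq> K" .
    show rx: "r x = x" if "x \<in> S2 \<inter> ball v \<epsilon>" for x using that by (simp add: r_def)
    show "r ` K = S2 \<inter> ball v \<epsilon>"
    proof
      show "S2 \<inter> ball v \<epsilon> \<subseteq> r ` K"
      proof
        fix x assume x: "x \<in> S2 \<inter> ball v \<epsilon>"
        show "x \<in> r ` K" using rx[OF x, symmetric] subsetD[OF sub x] by (rule image_eqI)
      qed
      show "r ` K \<subseteq> S2 \<inter> ball v \<epsilon>"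
      proof
        fix z assume "z \<in> r ` K"
        then obtain y where y: "z = r y" "y \<in> K" by blast
        have "norm y > 0" using K0 y by auto
        then show "z \<in> S2 \<inter> ball v \<epsilon>" unfolding mem using y by (simp add: r_def K_def field_simps)
      qed
    qed
  qed
qed

lemma connected_S2_cap:
  assumes "v \<in> S2" "0 < \<epsilon>" "\<epsilon> \<le> 1"
  shows "connected (S2 \<inter> ball v \<epsilon>)"
proof (rule S2_cap_retract_of_convex[OF assms])
  fix K and r :: "real^3 \<Rightarrow> real^3"
  assume *: "convex K" "continuous_on K r" "r ` K = S2 \<inter> ball v \<epsilon>"
  show ?thesis using connected_continuous_image[OF *(2) convex_connected[OF *(1)]] *(3) by simp
qed

lemma Borsukian_S2_cap:
  assumes "v \<in> S2" "0 < \<epsilon>" "\<epsilon> \<le> 1"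
  shows "Borsukian (S2 \<inter> ball v \<epsilon>)"
proof (rule S2_cap_retract_of_convex[OF assms])
  fix K and r :: "real^3 \<Rightarrow> real^3"
  assume *: "convex K" "continuous_on K r" "r ` K = S2 \<inter> ball v \<epsilon>" "S2 \<inter> ball v \<epsilon> \<subseteq> K"
    "\<And>x. x \<in> S2 \<inter> ball v \<epsilon> \<Longrightarrow> r x = x"
  show ?thesis
    by (rule Borsukian_retraction_gen[OF convex_imp_Borsukian[OF *(1)] *(2,3), of "\<lambda>x. x"])
      (use * in \<open>auto intro: continuous_on_id\<close>)
qed

text \<open>The inverse of the arc would embed a piece of the sphere into the real axis of the
  complex plane, whereas invariance of domain makes the image open in the plane.\<close>

lemma arc_no_open_subset_S2:
  fixes g :: "real \<Rightarrow> real^3"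
  assumes "arc g" "openin (top_of_set S2) U" "U \<subseteq> path_image g"
  shows "U = {}"
proof -
  obtain h where h: "homeomorphism {0..1} (path_image g) g h"
    using homeomorphism_arc[OF assms(1)] by blast
  let ?f = "\<lambda>x. complex_of_real (h x)"
  have inj: "inj_on h (path_image g)" using h by (metis homeomorphism_def inj_on_inverseI)
  have "openin (top_of_set (UNIV::complex set)) (?f ` U)"
  proof (rule invariance_of_domain_sphere_affine_set[OF _ _ _ _ _ _ assms(2)])
    show "continuous_on U ?f"
      by (intro continuous_intros continuous_on_subset[OF homeomorphism_cont2[OF h] assms(3)])
    show "inj_on ?f U" using inj_on_subset[OF inj assms(3)] by (simp add: inj_on_def)
  qed auto
  then have o: "open (?f ` U)" by simp
  show ?thesis
  proof (rule ccontr)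
    assume "U \<noteq> {}"
    then obtain x where x: "x \<in> U" by blast
    then obtain e where e: "e > 0" "ball (?f x) e \<subseteq> ?f ` U" using o by (meson image_eqI openE)
    have "?f x + \<i> * of_real (e/2) \<in> ball (?f x) e" using e(1) by (simp add: dist_norm norm_mult)
    then have "?f x + \<i> * of_real (e/2) \<in> ?f ` U" using e(2) by blast
    then obtain y where "?f x + \<i> * of_real (e/2) = ?f y" by blast
    then have "Im (?f x + \<i> * of_real (e/2)) = Im (?f y)" by simp
    then show False using e(1) by simp
  qed
qed

lemma singleton_not_open_S2: "\<not> openin (top_of_set S2) {N :: real^3}"
proof
  assume o: "openin (top_of_set S2) {N}"
  then have "N \<noteq> 0" using openin_imp_subset[OF o] by auto
  \<comment> \<open>The arc need not lie on the sphere, so a radius will do.\<close>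
  then have "arc (linepath N 0)" by (rule arc_linepath)
  moreover have "{N} \<subseteq> path_image (linepath N 0)" using pathstart_in_path_image[of "linepath N 0"] by simp
  ultimately show False using arc_no_open_subset_S2[OF _ o] by blast
qed

text \<open>Projection from a point \<open>N\<close> off the arc reduces this to the complement of
  an arc in the plane. The point \<open>N\<close> lost in the projection returns as a limit point of
  the rest.\<close>

lemma connected_S2_minus_arc:
  fixes g :: "real \<Rightarrow> real^3"
  assumes g: "arc g" "path_image g \<subseteq> S2"
  shows "connected (S2 - path_image g)"
proof -
  have cl: "closed (path_image g)" using g by (simp add: closed_arc_image)
  have op: "openin (top_of_set S2) (S2 - path_image g)"
    using cl by (simp add: Diff_eq openin_open_Int open_Compl)
  have "\<not> S2 \<subseteq> path_image g" using arc_no_open_subset_S2[OF g(1), of S2] by auto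
  then obtain N where N: "N \<in> S2" "N \<notin> path_image g" by blast
  obtain j k where jk: "homeomorphism (S2 - {N}) (UNIV :: complex set) j k"
    using punctured_S2_homeomorphic_complex[OF N(1)] unfolding homeomorphic_def by blast
  have sub: "path_image g \<subseteq> S2 - {N}" using g N by blast
  have ja: "arc (j \<circ> g)"
  proof -
    have 1: "continuous_on (path_image g) j"
      by (rule continuous_on_subset[OF homeomorphism_cont1[OF jk] sub])
    have 2: "inj_on j (path_image g)"
      by (rule inj_on_inverseI[of _ k]) (use homeomorphism_apply1[OF jk] sub in blast)
    show ?thesis using g(1) 1 2 unfolding arc_def
      by (auto simp: path_image_def intro: path_continuous_image comp_inj_on)
  qed
  have "connected (- path_image (j \<circ> g))" by (rule connected_arc_complement[OF ja]) simp
  then have c: "connected (k ` (- path_image (j \<circ> g)))"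
    by (rule connected_continuous_image[rotated]) (use homeomorphism_cont2[OF jk] continuous_on_subset in blast)
  have kj: "k (j x) = x" if "x \<in> S2 - {N}" for x using homeomorphism_apply1[OF jk that] .
  have jk': "j (k z) = z" for z using homeomorphism_apply2[OF jk] by simp
  have kr: "k z \<in> S2 - {N}" for z using homeomorphism_image2[OF jk] by blast
  have eq: "k ` (- path_image (j \<circ> g)) = S2 - {N} - path_image g"
  proof
    show "k ` (- path_image (j \<circ> g)) \<subseteq> S2 - {N} - path_image g"
    proof
      fix x assume "x \<in> k ` (- path_image (j \<circ> g))"
      then obtain z where z: "x = k z" "z \<notin> path_image (j \<circ> g)" by blast
      have "x \<notin> path_image g"
        using z jk'[of z] by (metis image_eqI path_image_compose)
      then show "x \<in> S2 - {N} - path_image g" using kr[of z] z by blast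
    qed
    show "S2 - {N} - path_image g \<subseteq> k ` (- path_image (j \<circ> g))"
    proof
      fix x assume x: "x \<in> S2 - {N} - path_image g"
      have "j x \<notin> path_image (j \<circ> g)"
      proof
        assume "j x \<in> path_image (j \<circ> g)"
        then obtain y where "y \<in> path_image g" "j x = j y" by (auto simp: path_image_compose)
        then show False using kj[of x] kj[of y] x sub by (metis DiffD1 DiffD2 subsetD)
      qed
      then show "x \<in> k ` (- path_image (j \<circ> g))" using kj[of x] x by (metis ComplI DiffD1 image_eqI)
    qed
  qed
  have "N \<in> closure (S2 - {N} - path_image g)"
  proof (rule ccontr)
    assume "N \<notin> closure (S2 - {N} - path_image g)"
    then obtain O' where O': "open O'" "N \<in> O'" "O' \<inter> (S2 - {N} - path_image g) = {}"
      unfolding closure_iff_nhds_not_empty by blast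
    have "openin (top_of_set S2) ((S2 - path_image g) \<inter> O')"
      using op O'(1) by (metis inf_commute openin_Int_open)
    moreover have "(S2 - path_image g) \<inter> O' = {N}" using O' N by blast
    ultimately show False using singleton_not_open_S2 by metis
  qed
  then have "S2 - path_image g \<subseteq> closure (S2 - {N} - path_image g)"
    using closure_subset[of "S2 - {N} - path_image g"] by blast
  then show ?thesis
    using connected_intermediate_closure[of "S2 - {N} - path_image g"] c unfolding eq by blast
qed

section \<open>Counting components by representatives\<close>

text \<open>Bounds on the number of components become statements about finite \<open>P\<close> of
  this kind, meaningful also when there are infinitely many components.\<close>

definition separated_in :: "'a::topological_space set \<Rightarrow> 'a set \<Rightarrow> bool" where
  "separated_in U P \<longleftrightarrow> P \<subseteq> U \<and> (\<forall>x\<in>P. \<forall>y\<in>P. connected_component U x y \<longrightarrow> x = y)"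

lemma connected_component_avoiding:
  assumes "connected_component (M - S) x y" "connected_component_set (M - S) x \<inter> A = {}"
  shows "connected_component (M - (S \<union> A)) x y"
  unfolding connected_component_def
proof (intro exI conjI)
  show "connected (connected_component_set (M - S) x)" by simp
  show "connected_component_set (M - S) x \<subseteq> M - (S \<union> A)"
    using connected_component_subset[of "M - S" x] assms(2) by blast
  show "x \<in> connected_component_set (M - S) x" "y \<in> connected_component_set (M - S) x"
    using assms(1) connected_component_in by force+
qed

text \<open>The open chord is connected, so it meets at most one component of \<open>S2 - S\<close>.
  The others survive unchanged, and that one falls into at most two parts.\<close>

lemma separated_in_chord_bound:
  assumes S: "closed S" and A: "closed A" "A \<subseteq> S2" and SA: "S \<inter> A = {p,q}" and pq: "p \<noteq> q"
    and conA: "connected (S2 - A)" "connected (A - {p,q})"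
    and bound: "\<And>P. finite P \<Longrightarrow> separated_in (S2 - S) P \<Longrightarrow> card P \<le> d"
    and P: "finite P" "separated_in (S2 - (S \<union> A)) P"
  shows "card P \<le> Suc d"
proof (cases "separated_in (S2 - S) P")
  case True
  then show ?thesis using bound[OF P(1)] by simp
next
  case False
  have PU: "P \<subseteq> S2 - (S \<union> A)" and sep: "\<And>x y. \<lbrakk>x \<in> P; y \<in> P; connected_component (S2 - (S \<union> A)) x y\<rbrakk> \<Longrightarrow> x = y"
    using P(2) unfolding separated_in_def by blast+
  have pS: "p \<in> S2" "q \<in> S2" using SA A by auto
  have meets: "connected_component_set (S2 - S) u \<inter> A \<noteq> {}"
    if "u \<in> P" "w \<in> P" "u \<noteq> w" "connected_component (S2 - S) u w" for u w
    using that connected_component_avoiding[OF that(4)] sep by blast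
  have same: "connected_component (S2 - S) u u'"
    if ne: "connected_component_set (S2 - S) u \<inter> A \<noteq> {}" "connected_component_set (S2 - S) u' \<inter> A \<noteq> {}" for u u'
  proof -
    obtain y y' where y: "connected_component (S2 - S) u y" "y \<in> A" "connected_component (S2 - S) u' y'" "y' \<in> A"
      using ne by blast
    have "y \<in> A - {p,q}" "y' \<in> A - {p,q}" "A - {p,q} \<subseteq> S2 - S"
      using y(1,3)[THEN connected_component_in] y SA A by auto
    then have "connected_component (S2 - S) y y'"
      unfolding connected_component_def using conA(2) by blast
    then show ?thesis using y by (meson connected_component_sym connected_component_trans)
  qed
  obtain x y where xy: "x \<in> P" "y \<in> P" "x \<noteq> y" "connected_component (S2 - S) x y"
    using False PU unfolding separated_in_def by blast
  \<comment> \<open>\<open>x\<close> and \<open>y\<close> lie in the component met by the chord.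
    After removal of \<open>x\<close>, another pair \<open>u\<close>, \<open>w\<close> in a common
    component would lie there too, so that \<open>x\<close>, \<open>u\<close>, \<open>w\<close>
    would represent three parts of it.\<close>
  have "separated_in (S2 - S) (P - {x})"
    unfolding separated_in_def
  proof (intro conjI ballI impI)
    show "P - {x} \<subseteq> S2 - S" using PU by blast
    fix u w assume uw: "u \<in> P - {x}" "w \<in> P - {x}" "connected_component (S2 - S) u w"
    show "u = w"
    proof (rule ccontr)
      assume "u \<noteq> w"
      then have xu: "connected_component (S2 - S) x u" using same meets xy uw by blast
      then have xw: "connected_component (S2 - S) x w" using uw(3) connected_component_trans by blast
      have "connected_component (S2 - (S \<union> A)) x u \<or> connected_component (S2 - (S \<union> A)) x w \<or>
        connected_component (S2 - (S \<union> A)) u w"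
        by (rule chord_splits_in_at_most_two[OF S A(1) SA pq pS conA(1) _ _ _ xu xw])
          (use PU uw xy in blast)+
      then show False using sep uw xy \<open>u \<noteq> w\<close> by blast
    qed
  qed
  then have "card (P - {x}) \<le> d" using bound P(1) by blast
  then show ?thesis using xy(1) P(1) by (simp add: card_Diff_singleton)
qed

section \<open>Corners at a vertex\<close>

lemma first_exit_time:
  fixes g :: "real \<Rightarrow> 'a::metric_space"
  assumes "path g" "open U" "pathstart g \<in> U" "pathfinish g \<notin> U"
  obtains t where "0 < t" "t \<le> 1" "g t \<notin> U" "\<And>s. 0 \<le> s \<Longrightarrow> s < t \<Longrightarrow> g s \<in> U"
proof -
  define Z where "Z = {0..1} \<inter> g -` (- U)"
  have "closed Z" unfolding Z_def using assms(1,2)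
    by (intro continuous_closed_preimage) (auto simp: path_def)
  then have "compact Z" unfolding Z_def by (metis compact_Icc compact_Int_closed Int_left_absorb)
  moreover have "1 \<in> Z" using assms(4) by (simp add: Z_def pathfinish_def)
  ultimately obtain t where t: "t \<in> Z" "\<And>s. s \<in> Z \<Longrightarrow> t \<le> s"
    using compact_attains_inf[of Z] by blast
  have "t \<noteq> 0" using t(1) assms(3) by (auto simp: Z_def pathstart_def)
  then show thesis using t that[of t] by (force simp: Z_def)
qed

text \<open>Each arc is cut at its first exit from the cap into an initial piece
  \<open>\<alpha> i\<close>, from \<open>v\<close> to a point \<open>w i\<close> of the outside
  \<open>X\<close>, and a tail \<open>\<beta> i\<close>. The initial pieces leave at most
  \<open>card I\<close> components. The tails may return and cut the cap further, but they stay away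
  from \<open>v\<close> and cannot separate points close to \<open>v\<close> that the initial pieces
  do not separate.\<close>

lemma components_at_vertex_bound:
  fixes v :: "real^3" and \<delta> :: "'i \<Rightarrow> real \<Rightarrow> real^3"
  assumes v: "v \<in> S2" and e: "0 < \<epsilon>" "\<epsilon> \<le> 1" and I: "finite I" "I \<noteq> {}"
    and arcs: "\<And>i. i \<in> I \<Longrightarrow> arc (\<delta> i)" and sph: "\<And>i. i \<in> I \<Longrightarrow> path_image (\<delta> i) \<subseteq> S2"
    and start: "\<And>i. i \<in> I \<Longrightarrow> pathstart (\<delta> i) = v"
    and finish: "\<And>i. i \<in> I \<Longrightarrow> pathfinish (\<delta> i) \<notin> ball v \<epsilon>"
    and disj: "\<And>i j. \<lbrakk>i \<in> I; j \<in> I; i \<noteq> j\<rbrakk> \<Longrightarrow>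
      path_image (\<delta> i) \<inter> path_image (\<delta> j) \<inter> ball v \<epsilon> \<subseteq> {v}"
  defines "\<K> \<equiv> {K \<in> components (S2 \<inter> ball v \<epsilon> - (\<Union>i\<in>I. path_image (\<delta> i))). v \<in> closure K}"
  shows "finite \<K> \<and> card \<K> \<le> card I"
proof -
  have "\<exists>t. 0 < t \<and> t \<le> 1 \<and> \<delta> i t \<notin> ball v \<epsilon> \<and> (\<forall>s. 0 \<le> s \<longrightarrow> s < t \<longrightarrow> \<delta> i s \<in> ball v \<epsilon>)" if i: "i \<in> I" for i
  proof -
    have "pathstart (\<delta> i) \<in> ball v \<epsilon>" using start[OF i] e by simp
    from first_exit_time[OF arc_imp_path[OF arcs[OF i]] open_ball this finish[OF i]]
    show ?thesis by metis
  qed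
  then obtain t where t: "\<And>i. i \<in> I \<Longrightarrow> 0 < t i" "\<And>i. i \<in> I \<Longrightarrow> t i \<le> 1" "\<And>i. i \<in> I \<Longrightarrow> \<delta> i (t i) \<notin> ball v \<epsilon>"
    "\<And>i s. \<lbrakk>i \<in> I; 0 \<le> s; s < t i\<rbrakk> \<Longrightarrow> \<delta> i s \<in> ball v \<epsilon>"
    by metis
  define X where "X = S2 - ball v \<epsilon>"
  define \<alpha> where "\<alpha> i = \<delta> i ` {0..t i}" for i
  define \<beta> where "\<beta> i = \<delta> i ` {t i..1}" for i
  define w where "w i = \<delta> i (t i)" for i
  have X: "closed X" "v \<notin> X" "S2 - X = S2 \<inter> ball v \<epsilon>"
    using e by (auto simp: X_def intro!: closed_Diff)
  have inj: "inj_on (\<delta> i) {0..1}" if "i \<in> I" for i using arcs[OF that] by (simp add: arc_def)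
  have d0: "\<delta> i 0 = v" if "i \<in> I" for i using start[OF that] by (simp add: pathstart_def)
  have im: "path_image (\<delta> i) = \<alpha> i \<union> \<beta> i" if "i \<in> I" for i
  proof -
    have "{0..1} = {0..t i} \<union> {t i..1}" using t(1,2)[OF that] by auto
    then show ?thesis by (simp add: path_image_def \<alpha>_def \<beta>_def image_Un)
  qed
  have cont: "continuous_on {0..1} (\<delta> i)" if "i \<in> I" for i
    using arc_imp_path[OF arcs[OF that]] by (simp add: path_def)
  have clb: "closed (\<beta> i)" if "i \<in> I" for i
    unfolding \<beta>_def using t(1,2)[OF that]
    by (intro compact_imp_closed compact_continuous_image continuous_on_subset[OF cont[OF that]]) auto
  have arca: "arc (subpath 0 (t i) (\<delta> i))" and ia: "path_image (subpath 0 (t i) (\<delta> i)) = \<alpha> i" if "i \<in> I" for i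
    using t(1,2)[OF that] by (auto intro!: arc_subpath_arc arcs[OF that] simp: path_image_subpath \<alpha>_def)
  have cla: "closed (\<alpha> i)" if "i \<in> I" for i
    using closed_arc_image[OF arca[OF that]] ia[OF that] by simp
  have sa: "\<alpha> i \<subseteq> S2" "\<beta> i \<subseteq> S2" if "i \<in> I" for i using sph[OF that] im[OF that] by auto
  have va: "v \<in> \<alpha> i" if "i \<in> I" for i
    unfolding \<alpha>_def using d0[OF that] t(1)[OF that] by (intro image_eqI[of _ _ 0]) auto
  have vb: "v \<notin> \<beta> i" if i: "i \<in> I" for i
  proof
    assume "v \<in> \<beta> i"
    then obtain s where "s \<in> {t i..1}" "\<delta> i 0 = \<delta> i s" using d0[OF i] by (auto simp: \<beta>_def)
    then show False using inj_onD[OF inj[OF i], of 0 s] t(1)[OF i] by auto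
  qed
  have wX: "w i \<in> X" if "i \<in> I" for i
  proof -
    have "\<delta> i (t i) \<in> path_image (\<delta> i)"
      unfolding path_image_def using t(1,2)[OF that] by (intro imageI) simp
    then show ?thesis unfolding w_def X_def using t(3)[OF that] sph[OF that] by blast
  qed
  have wa: "w i \<in> \<alpha> i" if "i \<in> I" for i
    unfolding w_def \<alpha>_def using t(1)[OF that] by (intro imageI) auto
  have aX: "X \<inter> \<alpha> i = {w i}" if "i \<in> I" for i
  proof -
    have "x = w i" if x: "x \<in> X" "x \<in> \<alpha> i" for x
    proof -
      obtain s where s: "x = \<delta> i s" "0 \<le> s" "s \<le> t i" using x(2) by (auto simp: \<alpha>_def)
      have "\<not> s < t i" using t(4)[OF \<open>i \<in> I\<close>, of s] x(1) s unfolding X_def by blast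
      then show ?thesis using s by (simp add: w_def)
    qed
    then show ?thesis using wX[OF that] wa[OF that] by blast
  qed
  have ends: "\<alpha> i - {v, w i} = \<delta> i ` {0<..<t i}" if "i \<in> I" for i
  proof -
    have "{0..t i} - {0, t i} = {0<..<t i}" by auto
    moreover have "\<alpha> i - {v, w i} = \<delta> i ` ({0..t i} - {0, t i})"
    proof -
      have "\<delta> i ` ({0..t i} - {0, t i}) = \<delta> i ` {0..t i} - \<delta> i ` {0, t i}"
        using t(1,2)[OF that] by (intro inj_on_image_set_diff[OF inj[OF that]]) auto
      then show ?thesis by (simp add: \<alpha>_def w_def d0[OF that])
    qed
    ultimately show ?thesis by simp
  qed
  have vw: "v \<noteq> w i" if "i \<in> I" for i using X(2) wX[OF that] by auto
  \<comment> \<open>The first initial piece meets \<open>X\<close> in one point and separates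
    nothing; every further one is a chord from \<open>v\<close> to \<open>X\<close>, since
    \<open>v\<close> already belongs to the set, and adds at most one component.\<close>
  have bound: "finite F \<Longrightarrow> F \<noteq> {} \<Longrightarrow> F \<subseteq> I \<Longrightarrow>
    \<forall>P. finite P \<longrightarrow> separated_in (S2 - (X \<union> (\<Union>i\<in>F. \<alpha> i))) P \<longrightarrow> card P \<le> card F" for F
  proof (induction rule: finite_ne_induct)
    case (singleton i)
    then have i: "i \<in> I" by simp
    show ?case
    proof (intro allI impI)
      fix P assume P: "finite P" "separated_in (S2 - (X \<union> (\<Union>i\<in>{i}. \<alpha> i))) P"
      have "x = y" if xy: "x \<in> P" "y \<in> P" for x y
      proof -
        have xy': "x \<in> S2 - (X \<union> \<alpha> i)" "y \<in> S2 - (X \<union> \<alpha> i)"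
          using xy P(2) by (auto simp: separated_in_def)
        have "connected_component (S2 - (X \<union> \<alpha> i)) x y"
        proof (rule Janiszewski_Borsukian[OF locally_connected_sphere X(1) _ cla[OF i]])
          have "w i \<in> S2" using sa(1)[OF i] wa[OF i] by blast
          then show "Borsukian (S2 - X \<inter> \<alpha> i)"
            unfolding aX[OF i] using punctured_S2_homeomorphic_complex Borsukian_UNIV
              homeomorphic_Borsukian homeomorphic_sym by blast
          show "connected_component (S2 - X) x y"
            unfolding connected_component_def X(3)
            using connected_S2_cap[OF v e] xy' X(3) by (intro exI[of _ "S2 \<inter> ball v \<epsilon>"]) blast
          show "connected_component (S2 - \<alpha> i) x y"
            unfolding connected_component_def
            using connected_S2_minus_arc[OF arca[OF i]] sa(1)[OF i] xy' unfolding ia[OF i]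
            by (intro exI[of _ "S2 - \<alpha> i"]) blast
        qed (use va[OF i] wX[OF i] in auto)
        then show ?thesis using P(2) xy by (auto simp: separated_in_def)
      qed
      then show "card P \<le> card {i}" using P(1) by (simp add: card_le_Suc0_iff_eq)
    qed
  next
    case (insert j F)
    then have j: "j \<in> I" and FI: "F \<subseteq> I" by auto
    let ?S = "X \<union> (\<Union>i\<in>F. \<alpha> i)"
    show ?case
    proof (intro allI impI)
      fix P assume P: "finite P" "separated_in (S2 - (X \<union> (\<Union>i\<in>insert j F. \<alpha> i))) P"
      have "card P \<le> Suc (card F)"
      proof (rule separated_in_chord_bound[OF _ cla[OF j] sa(1)[OF j] _ vw[OF j]])
        show "closed ?S" using X(1) cla FI insert.hyps(1) by (intro closed_Un closed_UN) auto
        show "?S \<inter> \<alpha> j = {v, w j}"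
        proof
          show "?S \<inter> \<alpha> j \<subseteq> {v, w j}"
          proof
            fix x assume x: "x \<in> ?S \<inter> \<alpha> j"
            show "x \<in> {v, w j}"
            proof (cases "x \<in> X")
              case True then show ?thesis using x aX[OF j] by auto
            next
              case False
              then obtain i where i: "i \<in> F" "x \<in> \<alpha> i" using x by blast
              have "x \<in> ball v \<epsilon>" using False x sa(1)[OF j] by (auto simp: X_def)
              moreover have "i \<noteq> j" "i \<in> I" using i insert.hyps FI by auto
              ultimately have "x \<in> {v}" using disj[of i j] x i im[of i] im[of j] j by blast
              then show ?thesis by simp
            qed
          qed
          show "{v, w j} \<subseteq> ?S \<inter> \<alpha> j"
            using insert.hyps(2) va FI j wX[OF j] wa[OF j] by blast
        qed
        show "connected (S2 - \<alpha> j)" using connected_S2_minus_arc[OF arca[OF j]] sa(1)[OF j] ia[OF j] by simp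
        show "connected (\<alpha> j - {v, w j})"
          unfolding ends[OF j] using t(1,2)[OF j]
          by (intro connected_continuous_image continuous_on_subset[OF cont[OF j]]) auto
        show "\<And>P. finite P \<Longrightarrow> separated_in (S2 - ?S) P \<Longrightarrow> card P \<le> card F"
          using insert.IH FI by blast
        have "X \<union> (\<Union>i\<in>insert j F. \<alpha> i) = ?S \<union> \<alpha> j" by auto
        then show "separated_in (S2 - (?S \<union> \<alpha> j)) P" using P(2) by simp
      qed (rule P(1))
      then show "card P \<le> card (insert j F)" using insert.hyps by simp
    qed
  qed
  \<comment> \<open>\<open>S\<close> and \<open>T\<close> meet exactly in \<open>X\<close>, whose
    complement is the cap and hence Borsukian, so points joined off \<open>S\<close> and off
    \<open>T\<close> are joined off both.\<close>
  define S where "S = X \<union> (\<Union>i\<in>I. \<alpha> i)"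
  define T where "T = X \<union> (\<Union>i\<in>I. \<beta> i)"
  have clS: "closed S" and clT: "closed T"
    unfolding S_def T_def using X(1) cla clb I by (auto intro!: closed_Un closed_UN)
  have ST: "S \<inter> T = X"
  proof
    show "S \<inter> T \<subseteq> X"
    proof
      fix x assume x: "x \<in> S \<inter> T"
      show "x \<in> X"
      proof (rule ccontr)
        assume nX: "x \<notin> X"
        then obtain i j where ij: "i \<in> I" "x \<in> \<alpha> i" "j \<in> I" "x \<in> \<beta> j" using x by (auto simp: S_def T_def)
        have b: "x \<in> ball v \<epsilon>" using nX sa(1)[OF ij(1)] ij(2) unfolding X_def by blast
        show False
        proof (cases "i = j")
          case True
          obtain s s' where s: "x = \<delta> i s" "s \<in> {0..t i}" "x = \<delta> i s'" "s' \<in> {t i..1}"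
            using ij(2,4) True unfolding \<alpha>_def \<beta>_def by blast
          then have "s = s'" using inj_onD[OF inj[OF ij(1)], of s s'] t(1,2)[OF ij(1)] by auto
          then have "s = t i" using s by auto
          then show False using s t(3)[OF ij(1)] b by simp
        next
          case False
          then have "x = v" using disj[OF ij(1,3)] ij im b by blast
          then show False using vb[OF ij(3)] ij(4) by simp
        qed
      qed
    qed
  qed (auto simp: S_def T_def)
  have SuT: "S2 - (S \<union> T) = S2 \<inter> ball v \<epsilon> - (\<Union>i\<in>I. path_image (\<delta> i))"
    using im by (auto simp: S_def T_def X_def)
  have "v \<notin> T" using vb X(2) by (auto simp: T_def)
  then obtain \<eta>0 where \<eta>0: "\<eta>0 > 0" "ball v \<eta>0 \<subseteq> - T"
    using clT by (meson ComplI open_Compl openE)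
  define \<eta> where "\<eta> = min \<eta>0 1"
  have \<eta>: "0 < \<eta>" "\<eta> \<le> 1" "ball v \<eta> \<inter> T = {}" using \<eta>0 by (auto simp: \<eta>_def)
  obtain i0 where i0: "i0 \<in> I" using I by blast
  have ne: "S \<noteq> {}" "T \<noteq> {}" using wX[OF i0] by (auto simp: S_def T_def)
  \<comment> \<open>Bounding all finite subfamilies also yields finiteness. Each piece is
    represented by a point so near to \<open>v\<close> that a smaller cap joins all these points off
    \<open>T\<close>.\<close>
  have "card G \<le> card I" if G: "G \<subseteq> \<K>" "finite G" for G
  proof -
    have "\<exists>a. a \<in> K \<and> a \<in> ball v \<eta>" if "K \<in> G" for K
    proof -
      have "v \<in> closure K" using that G(1) by (auto simp: \<K>_def)
      then show ?thesis using \<eta>(1) unfolding closure_approachable by (metis dist_commute mem_ball)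
    qed
    then obtain a where a: "\<And>K. K \<in> G \<Longrightarrow> a K \<in> K" "\<And>K. K \<in> G \<Longrightarrow> a K \<in> ball v \<eta>" by metis
    have comp: "K \<in> components (S2 - (S \<union> T))" if "K \<in> G" for K
      using that G(1) unfolding \<K>_def SuT by blast
    have inU: "a K \<in> S2 - (S \<union> T)" if "K \<in> G" for K
      using in_components_subset[OF comp[OF that]] a(1)[OF that] by blast
    have eqK: "K = L" if "K \<in> G" "L \<in> G" "connected_component (S2 - (S \<union> T)) (a K) (a L)" for K L
    proof -
      have "K = connected_component_set (S2 - (S \<union> T)) (a K)" "L = connected_component_set (S2 - (S \<union> T)) (a L)"
        using comp[OF that(1)] comp[OF that(2)] a(1)[OF that(1)] a(1)[OF that(2)]
        by (metis components_iff connected_component_eq)+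
      then show ?thesis using that(3) by (metis connected_component_eq mem_Collect_eq)
    qed
    have inja: "inj_on a G"
      using eqK inU by (metis connected_component_refl inj_onI)
    have "separated_in (S2 - S) (a ` G)"
      unfolding separated_in_def
    proof (intro conjI ballI impI)
      show "a ` G \<subseteq> S2 - S" using inU by auto
      fix x y assume xy: "x \<in> a ` G" "y \<in> a ` G" "connected_component (S2 - S) x y"
      obtain K L where KL: "x = a K" "K \<in> G" "y = a L" "L \<in> G" using xy by blast
      have "connected_component (S2 - T) x y"
        unfolding connected_component_def
        using connected_S2_cap[OF v \<eta>(1,2)] a(2) inU KL \<eta>(3)
        by (intro exI[of _ "S2 \<inter> ball v \<eta>"]) blast
      moreover have "Borsukian (S2 - S \<inter> T)" unfolding ST X(3) by (rule Borsukian_S2_cap[OF v e])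
      ultimately have "connected_component (S2 - (S \<union> T)) x y"
        using Janiszewski_Borsukian[OF locally_connected_sphere clS ne(1) clT ne(2)] xy(3) by blast
      then show "x = y" using eqK KL by blast
    qed
    then have "card (a ` G) \<le> card I" using bound[OF I order_refl] G(2) by (simp add: S_def)
    then show ?thesis using card_image[OF inja] by simp
  qed
  then show ?thesis using finite_if_finite_subsets_card_bdd[of \<K> "card I"] by blast
qed

section \<open>Separation of the sphere: lower bounds\<close>

context
  fixes N :: "real^3" and j :: "real^3 \<Rightarrow> complex" and k
  assumes N: "N \<in> S2" and jk: "homeomorphism (S2 - {N}) UNIV j k"
begin

text \<open>\<open>N\<close> is the point at infinity of the chart \<open>j\<close>; the map below is \<open>(z - p) / (z - q)\<close> in that
  chart.\<close>

definition inverse_difference :: "real^3 \<Rightarrow> real^3 \<Rightarrow> complex" where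
  "inverse_difference q x = (if x = N then 0 else 1 / (j x - j q))"

definition moebius_map :: "real^3 \<Rightarrow> real^3 \<Rightarrow> real^3 \<Rightarrow> complex" where
  "moebius_map p q x = 1 + (j q - j p) * inverse_difference q x"

lemma chart_inj: "x \<in> S2 - {N} \<Longrightarrow> y \<in> S2 - {N} \<Longrightarrow> j x = j y \<Longrightarrow> x = y"
  using homeomorphism_apply1[OF jk] by metis

lemma chart_inverse: "j (k z) = z" "k z \<in> S2 - {N}"
  using homeomorphism_apply2[OF jk] homeomorphism_image2[OF jk] by (blast, blast)

text \<open>The value 0 at \<open>N\<close> is the limit: closed discs of the chart are compact in
  the sphere and miss \<open>N\<close>, so the coordinate tends to infinity there.\<close>

lemma continuous_on_inverse_difference:
  assumes q: "q \<in> S2 - {N}"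
  shows "continuous_on (S2 - {q}) (inverse_difference q)"
  unfolding continuous_on_eq_continuous_within
proof
  fix x assume x: "x \<in> S2 - {q}"
  show "continuous (at x within S2 - {q}) (inverse_difference q)"
  proof (cases "x = N")
    case True
    have "((inverse_difference q) \<longlongrightarrow> 0) (at N within S2 - {q})"
    proof (rule tendstoI)
      fix e :: real assume e: "e > 0"
      let ?O = "- (k ` cball (j q) (1/e))"
      have "compact (k ` cball (j q) (1/e))"
        by (intro compact_continuous_image continuous_on_subset[OF homeomorphism_cont2[OF jk]]) auto
      then have "open ?O" by (simp add: compact_imp_closed open_Compl)
      moreover have "N \<in> ?O" using chart_inverse(2) by blast
      moreover have "dist (inverse_difference q x) 0 < e" if "x \<in> ?O" "x \<noteq> N" "x \<in> S2 - {q}" for x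
      proof -
        have kx: "k (j x) = x" using that homeomorphism_apply1[OF jk, of x] by simp
        have "j x \<notin> cball (j q) (1/e)"
        proof
          assume "j x \<in> cball (j q) (1/e)"
          then have "x \<in> k ` cball (j q) (1/e)" using kx by (metis imageI)
          then show False using that(1) by blast
        qed
        then have "norm (j x - j q) > 1/e" by (simp add: dist_norm norm_minus_commute)
        moreover have "1/e > 0" using e by simp
        ultimately have "1 / norm (j x - j q) < e" using e
          by (smt (verit) divide_less_eq mult.commute)
        then show ?thesis using that(2) by (simp add: inverse_difference_def norm_divide)
      qed
      ultimately show "\<forall>\<^sub>F x in at N within S2 - {q}. dist (inverse_difference q x) 0 < e"
        unfolding eventually_at_topological by blast
    qed
    then show ?thesis using True by (simp add: continuous_within inverse_difference_def)
  next
    case False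
    have "at x within S2 - {q} = at x within (S2 - {q} - {N})"
      using False by (intro at_within_nhd[of x "-{N}"]) auto
    moreover have "continuous_on (S2 - {q} - {N}) (\<lambda>x. 1 / (j x - j q))"
    proof (intro continuous_intros)
      show "continuous_on (S2 - {q} - {N}) j"
        by (rule continuous_on_subset[OF homeomorphism_cont1[OF jk]]) auto
      show "\<forall>x\<in>S2 - {q} - {N}. j x - j q \<noteq> 0" using chart_inj q by force
    qed
    then have "continuous_on (S2 - {q} - {N}) (inverse_difference q)"
      by (rule continuous_on_eq) (simp add: inverse_difference_def)
    then have "continuous (at x within (S2 - {q} - {N})) (inverse_difference q)"
      using x False by (simp add: continuous_on_eq_continuous_within)
    ultimately show ?thesis by simp
  qed
qed

lemma moebius_map_chart:
  assumes "q \<in> S2 - {N}" "x \<in> S2 - {N}" "x \<noteq> q"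
  shows "moebius_map p q x = (j x - j p) / (j x - j q)"
proof -
  have "j x - j q \<noteq> 0" using chart_inj assms by force
  then show ?thesis using assms by (simp add: moebius_map_def inverse_difference_def field_simps)
qed

lemma moebius_map_nonzero:
  assumes "q \<in> S2 - {N}" "p \<in> S2 - {N}" "x \<in> S2" "x \<noteq> q" "x \<noteq> p"
  shows "moebius_map p q x \<noteq> 0"
proof (cases "x = N")
  case True
  then show ?thesis by (simp add: moebius_map_def inverse_difference_def)
next
  case False
  then show ?thesis using moebius_map_chart[of q x p] chart_inj assms by force
qed

text \<open>Moving the zero along the path into the pole deforms the map to the constant 1.\<close>

lemma moebius_map_log_off_path:
  assumes b: "path \<beta>" "path_image \<beta> \<subseteq> S2 - {N}"
  shows "\<exists>g. continuous_on (S2 - path_image \<beta>) g \<and>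
    (\<forall>x\<in>S2 - path_image \<beta>. moebius_map (pathstart \<beta>) (pathfinish \<beta>) x = exp (g x))"
proof -
  let ?q = "pathfinish \<beta>" and ?X = "S2 - path_image \<beta>"
  have q: "?q \<in> S2 - {N}" using b(2) pathfinish_in_path_image by blast
  let ?h = "\<lambda>z. moebius_map (\<beta> (fst z)) ?q (snd z)"
  have "homotopic_with_canon (\<lambda>h. True) ?X (-{0}) (moebius_map (pathstart \<beta>) ?q) (\<lambda>x. 1)"
  proof (subst homotopic_with, simp, intro exI[of _ ?h] conjI)
    have c1: "continuous_on {0..1} (\<lambda>t. j (\<beta> t))"
      using b by (intro continuous_on_compose2[OF homeomorphism_cont1[OF jk]]) (auto simp: path_def path_image_def)
    have c2: "continuous_on ?X (inverse_difference ?q)"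
      by (rule continuous_on_subset[OF continuous_on_inverse_difference[OF q]]) auto
    have "continuous_on ({0..1} \<times> ?X) ?h"
      unfolding moebius_map_def
      by (intro continuous_intros continuous_on_compose2[OF c1] continuous_on_compose2[OF c2]) auto
    moreover have "?h z \<in> -{0}" if z: "z \<in> {0..1} \<times> ?X" for z
    proof -
      have bz: "\<beta> (fst z) \<in> path_image \<beta>" using z by (auto simp: path_image_def)
      then have "snd z \<noteq> \<beta> (fst z)" "snd z \<noteq> ?q" "snd z \<in> S2" using z pathfinish_in_path_image[of \<beta>] by auto
      moreover have "\<beta> (fst z) \<in> S2 - {N}" using bz b(2) by blast
      ultimately have "?h z \<noteq> 0" using moebius_map_nonzero[OF q] by blast
      then show ?thesis by simp
    qed
    ultimately show "continuous_map (prod_topology (top_of_set {0..1}) (top_of_set ?X)) (top_of_set (-{0})) ?h"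
      by (simp add: prod_topology_subtopology_eu continuous_map_subtopology_eu image_subset_iff Pi_iff)
    show "\<forall>x\<in>topspace (top_of_set ?X). ?h (0, x) = moebius_map (pathstart \<beta>) ?q x"
      by (simp add: pathstart_def)
    show "\<forall>x\<in>topspace (top_of_set ?X). ?h (1, x) = 1"
      by (simp add: pathfinish_def moebius_map_def)
  qed simp
  then show ?thesis using inessential_eq_continuous_logarithm by blast
qed

text \<open>On a circle about \<open>p\<close> with \<open>q\<close> outside, the map winds once
  around 0, so a logarithm would have to grow by 2 pi i along a closed curve.\<close>

lemma moebius_map_no_log:
  assumes p: "p \<in> S2 - {N}" and q: "q \<in> S2 - {N}" and pq: "p \<noteq> q"
    and G: "continuous_on (S2 - {p,q}) G" "\<And>x. x \<in> S2 - {p,q} \<Longrightarrow> moebius_map p q x = exp (G x)"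
  shows False
proof -
  define P where "P = j p"
  define D where "D = j p - j q"
  have D: "D \<noteq> 0" using chart_inj[OF p q] pq by (auto simp: D_def)
  \<comment> \<open>With half the distance between the two points as radius, the denominator on the
    circle is \<open>D\<close> times a factor \<open>1 + u * exp (\<i> * \<theta>)\<close> with
    \<open>norm u = 1/2\<close>, which has a principal logarithm.\<close>
  define r where "r = norm D / 2"
  have r: "r > 0" using D by (simp add: r_def)
  define u where "u = of_real r / D"
  have u: "norm u = 1/2" using D by (simp add: u_def r_def norm_divide)
  then have u0: "u \<noteq> 0" by auto
  define c where "c \<theta> = P + of_real r * exp (\<i> * of_real \<theta>)" for \<theta> :: real
  have E: "norm (exp (\<i> * of_real \<theta>)) = 1" for \<theta> :: real by simp
  have cp: "c \<theta> \<noteq> j p" for \<theta> using r by (simp add: c_def P_def)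
  have cq: "c \<theta> - j q = D * (1 + u * exp (\<i> * of_real \<theta>))" for \<theta>
    using D by (simp add: c_def P_def D_def u_def field_simps)
  have re: "Re (1 + u * exp (\<i> * of_real \<theta>)) > 0" for \<theta>
  proof -
    have "\<bar>Re (u * exp (\<i> * of_real \<theta>))\<bar> \<le> norm (u * exp (\<i> * of_real \<theta>))" by (rule abs_Re_le_cmod)
    also have "\<dots> = 1/2" using u E by (simp add: norm_mult)
    finally show ?thesis unfolding plus_complex.sel one_complex.sel by linarith
  qed
  then have nz: "1 + u * exp (\<i> * of_real \<theta>) \<noteq> 0" for \<theta> by (metis less_irrefl zero_complex.sel(1))
  have cq': "c \<theta> \<noteq> j q" for \<theta> using cq[of \<theta>] nz[of \<theta>] D by auto
  have kc: "k (c \<theta>) \<in> S2 - {p,q}" for \<theta>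
    using chart_inverse[of "c \<theta>"] cp[of \<theta>] cq'[of \<theta>] by (metis Diff_iff insert_iff empty_iff)
  have cancel: "x / (D * m) * m = x / D" if "m \<noteq> 0" for x m :: complex using that by simp
  let ?I = "{0..2*pi}"
  let ?L = "\<lambda>\<theta>. G (k (c \<theta>)) + Ln (1 + u * exp (\<i> * of_real \<theta>))"
  let ?R = "\<lambda>\<theta>. \<i> * of_real \<theta> + Ln u"
  \<comment> \<open>Both are logarithms of the numerator divided by \<open>D\<close>; the left one
    returns to its initial value, the right one grows by 2 pi i.\<close>
  have "?L 0 - ?R 0 = ?L (2*pi) - ?R (2*pi)"
  proof (rule exp_logs_differ_by_constant[of ?I])
    have cc: "continuous_on ?I c" unfolding c_def by (intro continuous_intros)
    have "continuous_on ?I (\<lambda>\<theta>. k (c \<theta>))"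
      by (rule continuous_on_compose2[OF homeomorphism_cont2[OF jk] cc]) simp
    then have "continuous_on ?I (\<lambda>\<theta>. G (k (c \<theta>)))"
      by (rule continuous_on_compose2[OF G(1)]) (use kc in blast)
    then show "continuous_on ?I ?L"
      using re by (intro continuous_intros) (auto simp: complex_nonpos_Reals_iff not_le)
    show "continuous_on ?I ?R" by (intro continuous_intros)
    show "exp (?L \<theta>) = exp (?R \<theta>)" for \<theta>
    proof -
      have "exp (?L \<theta>) = moebius_map p q (k (c \<theta>)) * (1 + u * exp (\<i> * of_real \<theta>))"
        using G(2)[OF kc] nz by (simp add: exp_add)
      also have "moebius_map p q (k (c \<theta>)) = (c \<theta> - j p) / (c \<theta> - j q)"
        using moebius_map_chart[OF q chart_inverse(2)[of "c \<theta>"]] kc[of \<theta>] chart_inverse(1) by auto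
      also have "\<dots> * (1 + u * exp (\<i> * of_real \<theta>)) = (c \<theta> - j p) / D"
        unfolding cq by (rule cancel[OF nz])
      also have "\<dots> = u * exp (\<i> * of_real \<theta>)" by (simp add: c_def P_def u_def)
      also have "\<dots> = exp (?R \<theta>)" using u0 by (simp add: exp_add)
      finally show ?thesis .
    qed
  qed auto
  moreover have e: "exp (\<i> * of_real (2*pi)) = exp (\<i> * of_real 0)" by (simp add: mult.commute)
  moreover have "c 0 = c (2*pi)" unfolding c_def e ..
  ultimately show False by simp
qed

end

lemma openin_S2_component:
  assumes "closed S"
  shows "openin (top_of_set S2) (connected_component_set (S2 - S) x)"
proof -
  have "openin (top_of_set (S2 - S)) (connected_component_set (S2 - S) x)"
    by (intro openin_connected_component_locally_connected locally_connected_Diff_closed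
        locally_connected_sphere assms)
  moreover have "openin (top_of_set S2) (S2 - S)"
    using assms by (simp add: Diff_eq openin_open_Int open_Compl)
  ultimately show ?thesis using openin_trans by blast
qed

lemma arc_interior_connected:
  assumes "arc g"
  shows "connected (path_image g - {pathstart g, pathfinish g})"
  using connected_simple_path_endless[OF arc_imp_simple_path[OF assms]] .

text \<open>The Moebius map with zero and pole at the end points of the chord has a logarithm off the
  path-connected set and one off the chord; if no component were split, the two would fit together
  to a logarithm on the sphere without these end points.\<close>

lemma chord_splits_some_component:
  assumes A: "closed A" "path_connected A" "A \<subseteq> S2"
    and g: "arc g" "path_image g \<subseteq> S2" and Ag: "A \<inter> path_image g = {pathstart g, pathfinish g}"
    and N: "N \<in> S2" "N \<notin> A" "N \<notin> path_image g"
  shows "\<exists>a b. a \<in> S2 - (A \<union> path_image g) \<and> b \<in> S2 - (A \<union> path_image g) \<and>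
    connected_component (S2 - A) a b \<and> \<not> connected_component (S2 - (A \<union> path_image g)) a b"
proof (rule ccontr)
  let ?g = "path_image g" and ?p = "pathstart g" and ?q = "pathfinish g"
  assume "\<not> ?thesis"
  then have cc: "connected_component (S2 - (A \<union> ?g)) a b"
    if "a \<in> S2 - (A \<union> ?g)" "b \<in> S2 - (A \<union> ?g)" "connected_component (S2 - A) a b" for a b
    using that by blast
  have clg: "closed ?g" using g(1) by (simp add: closed_arc_image)
  obtain j k where jk: "homeomorphism (S2 - {N}) (UNIV :: complex set) j k"
    using punctured_S2_homeomorphic_complex[OF N(1)] unfolding homeomorphic_def by blast
  let ?f = "moebius_map N j ?p ?q"
  have pqA: "?p \<in> A" "?q \<in> A" using Ag by auto
  obtain \<beta> where b: "path \<beta>" "path_image \<beta> \<subseteq> A" "pathstart \<beta> = ?p" "pathfinish \<beta> = ?q"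
    using A(2) pqA unfolding path_connected_def by blast
  have "path_image \<beta> \<subseteq> S2 - {N}" using b(2) A(3) N(2) by blast
  then obtain g1 where g1: "continuous_on (S2 - path_image \<beta>) g1" "\<And>x. x \<in> S2 - path_image \<beta> \<Longrightarrow> ?f x = exp (g1 x)"
    using moebius_map_log_off_path[OF N(1) jk b(1)] unfolding b(3,4) by blast
  have gN: "?g \<subseteq> S2 - {N}" using g(2) N(3) by blast
  then obtain g2 where g2: "continuous_on (S2 - ?g) g2" "\<And>x. x \<in> S2 - ?g \<Longrightarrow> ?f x = exp (g2 x)"
    using moebius_map_log_off_path[OF N(1) jk arc_imp_path[OF g(1)]] by blast
  have pN: "?p \<in> S2 - {N}" "?q \<in> S2 - {N}" using gN by (auto simp: pathstart_in_path_image pathfinish_in_path_image)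
  have pq: "?p \<noteq> ?q" using arc_distinct_ends[OF g(1)] by simp
  have int: "?g - {?p,?q} \<subseteq> S2 - A" using Ag g(2) by blast
  have "?g - {?p,?q} \<noteq> {}" using simple_path_endless[OF arc_imp_simple_path[OF g(1)]] by auto
  then obtain m where m: "m \<in> ?g - {?p,?q}" by blast
  \<comment> \<open>The component that contains the whole open chord.\<close>
  define C where "C = connected_component_set (S2 - A) m"
  have gC: "?g - {?p,?q} \<subseteq> C"
    unfolding C_def by (rule connected_component_maximal[OF m arc_interior_connected[OF g(1)] int])
  have CA: "C \<subseteq> S2 - A" unfolding C_def by (rule connected_component_subset)
  have CC: "connected_component (S2 - A) a b" if "a \<in> C" "b \<in> C" for a b
    using that unfolding C_def by (metis connected_component_sym connected_component_trans mem_Collect_eq)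
  have g1C: "continuous_on C g1" "\<And>x. x \<in> C \<Longrightarrow> ?f x = exp (g1 x)"
    using continuous_on_subset[OF g1(1)] g1(2) CA b(2) by blast+
  \<comment> \<open>On \<open>C\<close> without the chord both logarithms are valid. As nothing is
    split, this set lies in a single component of the complement of \<open>A \<union> ?g\<close>, so
    they differ there by a constant.\<close>
  have "\<exists>c. exp c = 1 \<and> (\<forall>x\<in>C - ?g. g1 x = g2 x + c)"
  proof (cases "C - ?g = {}")
    case True
    then show ?thesis by (intro exI[of _ 0]) auto
  next
    case False
    then obtain a where a: "a \<in> C" "a \<notin> ?g" by blast
    have "g1 x = g2 x + (g1 a - g2 a)" if x: "x \<in> C - ?g" for x
    proof -
      have "connected_component (S2 - (A \<union> ?g)) x a" using cc[of x a] CC[of x a] x a CA by blast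
      then obtain K where K: "connected K" "K \<subseteq> S2 - (A \<union> ?g)" "x \<in> K" "a \<in> K"
        unfolding connected_component_def by blast
      have "g1 x - g2 x = g1 a - g2 a"
      proof (rule exp_logs_differ_by_constant[OF K(1) _ _ _ K(3,4)])
        show "continuous_on K g1" using K(2) b(2) by (intro continuous_on_subset[OF g1(1)]) blast
        show "continuous_on K g2" using K(2) by (intro continuous_on_subset[OF g2(1)]) blast
        show "exp (g1 y) = exp (g2 y)" if "y \<in> K" for y
        proof -
          have "y \<in> S2 - path_image \<beta>" "y \<in> S2 - ?g" using that K(2) b(2) by blast+
          then show ?thesis using g1(2)[of y] g2(2)[of y] by simp
        qed
      qed
      then show ?thesis by (simp add: algebra_simps)
    qed
    moreover have "exp (g1 a) = exp (g2 a)"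
      using g1C(2)[OF a(1)] g2(2)[of a] a CA by auto
    ultimately show ?thesis by (intro exI[of _ "g1 a - g2 a"]) (auto simp: exp_diff)
  qed
  then obtain c where c: "exp c = 1" "\<And>x. x \<in> C - ?g \<Longrightarrow> g1 x = g2 x + c" by blast
  \<comment> \<open>\<open>g1\<close> serves on the open chord and \<open>g2 + c\<close> on
    \<open>A\<close> without the end points, where the other one is not known to be a
    logarithm.\<close>
  define G where "G x = (if x \<in> C then g1 x else g2 x + c)" for x
  have dom: "S2 - {?p,?q} = C \<union> (S2 - ?g)"
    using gC CA pqA pathstart_in_path_image[of g] pathfinish_in_path_image[of g] by blast
  have sub: "C \<union> (S2 - ?g) \<subseteq> S2" using CA by blast
  have o1: "openin (top_of_set (C \<union> (S2 - ?g))) C"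
    by (rule openin_subset_trans[OF _ _ sub]) (auto simp: C_def intro!: openin_S2_component A(1))
  have "openin (top_of_set S2) (S2 - ?g)" using clg by (simp add: Diff_eq openin_open_Int open_Compl)
  then have o2: "openin (top_of_set (C \<union> (S2 - ?g))) (S2 - ?g)"
    by (rule openin_subset_trans[OF _ _ sub]) auto
  have "continuous_on (S2 - {?p,?q}) G"
    unfolding dom G_def
  proof (rule continuous_on_cases_local_open[OF o1 o2 g1C(1)])
    show "continuous_on (S2 - ?g) (\<lambda>x. g2 x + c)" by (intro continuous_intros g2(1))
  qed (use c(2) in blast)
  moreover have "?f x = exp (G x)" if "x \<in> S2 - {?p,?q}" for x
    using that g1C(2)[of x] g2(2)[of x] c(1) unfolding dom G_def by (auto simp: exp_add)
  ultimately show False by (rule moebius_map_no_log[OF N(1) jk pN pq])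
qed

section \<open>Sets with empty interior; adding chords and arcs\<close>

text \<open>Empty interior relative to the sphere: representatives can be moved off such a set
  inside their open components.\<close>

definition thin :: "(real^3) set \<Rightarrow> bool" where
  "thin B \<longleftrightarrow> (\<forall>U. openin (top_of_set S2) U \<longrightarrow> U \<subseteq> B \<longrightarrow> U = {})"

lemma thin_Un:
  assumes "closed B" "thin B" "thin C"
  shows "thin (B \<union> C)"
  unfolding thin_def
proof (intro allI impI)
  fix U assume U: "openin (top_of_set S2) U" "U \<subseteq> B \<union> C"
  have "openin (top_of_set S2) (U - B)"
    using U(1) assms(1) by (simp add: Diff_eq openin_Int_open open_Compl)
  then have "U - B = {}" using assms(3) U(2) unfolding thin_def by blast
  then show "U = {}" using assms(2) U unfolding thin_def by blast
qed

lemma thin_arc: "arc g \<Longrightarrow> thin (path_image g)"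
  unfolding thin_def using arc_no_open_subset_S2 by blast

lemma thin_singleton: "thin {x}"
  unfolding thin_def using singleton_not_open_S2[of x] subset_singletonD by metis

lemma thin_perturb:
  assumes "closed A" "thin B" "x \<in> S2 - A"
  shows "\<exists>y. y \<in> S2 - (A \<union> B) \<and> connected_component (S2 - A) x y"
proof -
  have "connected_component_set (S2 - A) x \<noteq> {}"
    unfolding connected_component_eq_empty using assms(3) by blast
  then obtain y where "y \<in> connected_component_set (S2 - A) x" "y \<notin> B"
    using openin_S2_component[OF assms(1), of x] assms(2) unfolding thin_def by blast
  then show ?thesis using connected_component_subset[of "S2 - A" x] by blast
qed

text \<open>Every point moves off \<open>B\<close> within its own component of
  \<open>S2 - A\<close>, and removing \<open>B\<close> merges no components. The last clause
  remembers these components, because \<open>separated_in_add_chord\<close> must keep the moved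
  points out of the one that it splits.\<close>

lemma separated_in_thin:
  assumes A: "closed A" and B: "thin B" and P: "finite P" "separated_in (S2 - A) P"
  shows "\<exists>P'. finite P' \<and> card P' = card P \<and> separated_in (S2 - (A \<union> B)) P' \<and>
    (\<forall>y\<in>P'. \<exists>x\<in>P. connected_component (S2 - A) x y)"
proof -
  have PU: "P \<subseteq> S2 - A" and sep: "\<And>x y. \<lbrakk>x \<in> P; y \<in> P; connected_component (S2 - A) x y\<rbrakk> \<Longrightarrow> x = y"
    using P(2) unfolding separated_in_def by blast+
  have "\<exists>y. y \<in> S2 - (A \<union> B) \<and> connected_component (S2 - A) x y" if "x \<in> P" for x
    using thin_perturb[OF A B] that PU by blast
  then obtain h where h: "\<And>x. x \<in> P \<Longrightarrow> h x \<in> S2 - (A \<union> B)" "\<And>x. x \<in> P \<Longrightarrow> connected_component (S2 - A) x (h x)"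
    by metis
  have eq: "x = y" if "x \<in> P" "y \<in> P" "connected_component (S2 - A) (h x) (h y)" for x y
    using sep[of x y] h(2)[OF that(1)] h(2)[OF that(2)] that
    by (meson connected_component_sym connected_component_trans)
  have "inj_on h P"
  proof (rule inj_onI)
    fix x y assume xy: "x \<in> P" "y \<in> P" "h x = h y"
    show "x = y" using eq[OF xy(1,2)] h(1)[OF xy(1)] xy(3) by auto
  qed
  moreover have "separated_in (S2 - (A \<union> B)) (h ` P)"
    unfolding separated_in_def
  proof (intro conjI ballI impI)
    show "h ` P \<subseteq> S2 - (A \<union> B)" using h(1) by blast
    fix x' y' assume xy: "x' \<in> h ` P" "y' \<in> h ` P" "connected_component (S2 - (A \<union> B)) x' y'"
    then have "connected_component (S2 - A) x' y'" by (meson connected_component_of_subset Diff_mono order_refl sup_ge1)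
    then show "x' = y'" using eq xy by blast
  qed
  ultimately show ?thesis using P(1) h(2) by (intro exI[of _ "h ` P"]) (auto simp: card_image)
qed

text \<open>In the component that is split, the representative, if there is one, gives way to points
  \<open>a\<close> and \<open>b\<close> in different parts; all other representatives are moved off
  the chord.\<close>

lemma separated_in_add_chord:
  assumes A: "closed A" "path_connected A" "A \<subseteq> S2" "thin A"
    and g: "arc g" "path_image g \<subseteq> S2" and Ag: "A \<inter> path_image g = {pathstart g, pathfinish g}"
    and P: "finite P" "separated_in (S2 - A) P"
  shows "\<exists>P'. finite P' \<and> Suc (card P) \<le> card P' \<and> separated_in (S2 - (A \<union> path_image g)) P'"
proof -
  let ?g = "path_image g"
  have "thin (A \<union> ?g)" by (intro thin_Un thin_arc A g)
  then have "\<not> S2 \<subseteq> A \<union> ?g" unfolding thin_def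
    by (metis openin_subtopology_self sphere_eq_empty not_one_less_zero)
  then obtain N where N: "N \<in> S2" "N \<notin> A" "N \<notin> ?g" by blast
  obtain a b where ab: "a \<in> S2 - (A \<union> ?g)" "b \<in> S2 - (A \<union> ?g)" "connected_component (S2 - A) a b"
    "\<not> connected_component (S2 - (A \<union> ?g)) a b"
    using chord_splits_some_component[OF A(1-3) g Ag N] by blast
  have sep: "\<And>x y. \<lbrakk>x \<in> P; y \<in> P; connected_component (S2 - A) x y\<rbrakk> \<Longrightarrow> x = y"
    using P(2) unfolding separated_in_def by blast
  define Q where "Q = {x \<in> P. \<not> connected_component (S2 - A) x a}"
  have "P - Q \<subseteq> {x}" if "x \<in> P - Q" for x
  proof
    fix y assume "y \<in> P - Q"
    then have "connected_component (S2 - A) y x"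
      using that unfolding Q_def by (auto intro: connected_component_trans connected_component_sym)
    then show "y \<in> {x}" using sep \<open>y \<in> P - Q\<close> that by blast
  qed
  then have "card (P - Q) \<le> 1"
    by (cases "P - Q = {}") (auto simp: subset_singleton_iff card_le_Suc0_iff_eq P(1))
  moreover have QP: "Q \<subseteq> P" by (auto simp: Q_def)
  then have "card P = card Q + card (P - Q)"
    using P(1) by (metis card_Diff_subset card_mono finite_subset le_add_diff_inverse)
  ultimately have cQ: "card P \<le> Suc (card Q)" by simp
  have finQ: "finite Q" using QP P(1) finite_subset by blast
  have "separated_in (S2 - A) Q" using P(2) QP unfolding separated_in_def by blast
  then obtain Q' where Q': "finite Q'" "card Q' = card Q" "separated_in (S2 - (A \<union> ?g)) Q'"
    "\<And>y. y \<in> Q' \<Longrightarrow> \<exists>x\<in>Q. connected_component (S2 - A) x y"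
    using separated_in_thin[OF A(1) thin_arc[OF g(1)] finQ] by blast
  have mono: "connected_component (S2 - A) x y" if "connected_component (S2 - (A \<union> ?g)) x y" for x y
    using that by (meson connected_component_of_subset Diff_mono order_refl sup_ge1)
  have nQ: "\<not> connected_component (S2 - A) y a" "\<not> connected_component (S2 - A) y b"
    "\<not> connected_component (S2 - A) a y" "\<not> connected_component (S2 - A) b y" if y: "y \<in> Q'" for y
  proof -
    obtain x where x: "x \<in> Q" "connected_component (S2 - A) x y" using Q'(4)[OF y] by blast
    show 1: "\<not> connected_component (S2 - A) y a"
      using x unfolding Q_def by (auto dest: connected_component_trans)
    then show 2: "\<not> connected_component (S2 - A) y b"
      using ab(3) by (meson connected_component_trans connected_component_sym)
    show "\<not> connected_component (S2 - A) a y" using 1 connected_component_sym by blast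
    show "\<not> connected_component (S2 - A) b y" using 2 connected_component_sym by blast
  qed
  have ra: "connected_component (S2 - A) a a" "connected_component (S2 - A) b b"
    using ab(1,2) by auto
  have ne: "a \<noteq> b" "a \<notin> Q'" "b \<notin> Q'"
    using ab nQ(1)[of a] nQ(2)[of b] ra by auto
  have "separated_in (S2 - (A \<union> ?g)) (insert a (insert b Q'))"
    unfolding separated_in_def
  proof (intro conjI ballI impI)
    show "insert a (insert b Q') \<subseteq> S2 - (A \<union> ?g)" using ab(1,2) Q'(3) unfolding separated_in_def by blast
    fix x y assume xy: "x \<in> insert a (insert b Q')" "y \<in> insert a (insert b Q')"
      "connected_component (S2 - (A \<union> ?g)) x y"
    have "\<not> connected_component (S2 - (A \<union> ?g)) b a" using ab(4) connected_component_sym by blast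
    then show "x = y" using xy nQ mono ab(4) Q'(3) unfolding separated_in_def by blast
  qed
  moreover have "card (insert a (insert b Q')) = Suc (Suc (card Q))" using ne Q'(1,2) by simp
  ultimately show ?thesis using cQ Q'(1) by (intro exI[of _ "insert a (insert b Q')"]) simp
qed

text \<open>Up to its first return to \<open>A\<close> the arc is a chord and yields a new
  representative; the remainder is dealt with by moving points off it.\<close>

lemma separated_in_add_arc:
  assumes A: "closed A" "path_connected A" "A \<subseteq> S2" "thin A"
    and g: "arc g" "path_image g \<subseteq> S2" and fin: "finite (A \<inter> path_image g)"
    and ends: "pathstart g \<in> A" "pathfinish g \<in> A"
    and P: "finite P" "separated_in (S2 - A) P"
  shows "\<exists>P'. finite P' \<and> Suc (card P) \<le> card P' \<and> separated_in (S2 - (A \<union> path_image g)) P'"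
proof -
  have inj: "inj_on g {0..1}" using g(1) by (simp add: arc_def)
  \<comment> \<open>Time 0 is left out because the arc starts in \<open>A\<close>. Finiteness of the
    intersection keeps the return times from accumulating there, so a first positive one
    exists.\<close>
  define Z where "Z = {t \<in> {0<..1}. g t \<in> A}"
  have "finite Z"
  proof (rule finite_imageD[of g])
    show "finite (g ` Z)" by (rule finite_subset[OF _ fin]) (auto simp: Z_def path_image_def)
    show "inj_on g Z" by (rule inj_on_subset[OF inj]) (auto simp: Z_def)
  qed
  moreover have "1 \<in> Z" using ends(2) by (simp add: Z_def pathfinish_def)
  ultimately have t: "Min Z \<in> Z" "\<And>s. s \<in> Z \<Longrightarrow> Min Z \<le> s" using Min_in by auto
  define t where "t = Min Z"
  have t01: "0 < t" "t \<le> 1" "g t \<in> A" using t(1) by (auto simp: t_def Z_def)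
  define h where "h = subpath 0 t g"
  have h: "arc h" "path_image h = g ` {0..t}" "pathstart h = g 0" "pathfinish h = g t"
    unfolding h_def using t01 by (auto intro!: arc_subpath_arc g(1) simp: path_image_subpath)
  have hg: "path_image h \<subseteq> path_image g" unfolding h(2) path_image_def[of g] using t01 by (intro image_mono) auto
  have "A \<inter> path_image h = {pathstart h, pathfinish h}"
  proof
    show "A \<inter> path_image h \<subseteq> {pathstart h, pathfinish h}"
    proof
      fix x assume x: "x \<in> A \<inter> path_image h"
      then obtain s where s: "x = g s" "0 \<le> s" "s \<le> t" unfolding h(2) by auto
      show "x \<in> {pathstart h, pathfinish h}"
      proof (cases "s = 0")
        case True then show ?thesis using s h by simp
      next
        case False
        then have "s \<in> Z" using s x t01 by (simp add: Z_def)
        then have "s = t" using t(2)[of s] s by (simp add: t_def)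
        then show ?thesis using s h by simp
      qed
    qed
    show "{pathstart h, pathfinish h} \<subseteq> A \<inter> path_image h"
      using ends(1) t01 pathstart_in_path_image[of h] pathfinish_in_path_image[of h] h
      by (auto simp: pathstart_def)
  qed
  then obtain P1 where P1: "finite P1" "Suc (card P) \<le> card P1" "separated_in (S2 - (A \<union> path_image h)) P1"
    using separated_in_add_chord[OF A h(1) _ _ P] hg g(2) by blast
  have "closed (A \<union> path_image h)" using A(1) h(1) by (simp add: closed_Un closed_arc_image)
  then obtain P2 where "finite P2" "card P2 = card P1" "separated_in (S2 - (A \<union> path_image h \<union> path_image g)) P2"
    using separated_in_thin[OF _ thin_arc[OF g(1)] P1(1,3)] by blast
  moreover have "A \<union> path_image h \<union> path_image g = A \<union> path_image g" using hg by blast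
  ultimately show ?thesis using P1(2) by (intro exI[of _ P2]) auto
qed

lemma thin_UN:
  assumes "finite I" "\<And>i. i \<in> I \<Longrightarrow> closed (B i)" "\<And>i. i \<in> I \<Longrightarrow> thin (B i)"
  shows "thin (\<Union>i\<in>I. B i)"
  using assms
proof (induction rule: finite_induct)
  case empty
  show ?case by (simp add: thin_def)
next
  case (insert i I)
  then show ?case using thin_Un[of "B i" "\<Union>i\<in>I. B i"] by simp
qed

section \<open>Counting cells and corners of a drawing\<close>

text \<open>Otherwise a walk that starts in \<open>W\<close> could use edges of \<open>F\<close>
  only and would never leave \<open>W\<close>, but connectedness leads it to an end of a missing
  edge.\<close>

lemma exists_further_edge_at:
  assumes con: "graph_connected V E ends" and mg: "multigraph V E ends"
    and F: "F \<subseteq> E" "F \<noteq> E" and W: "W \<subseteq> V" "W \<noteq> {}" and FW: "\<And>e. e \<in> F \<Longrightarrow> ends e \<subseteq> W"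
  shows "\<exists>e\<in>E - F. ends e \<inter> W \<noteq> {}"
proof (rule ccontr)
  assume no: "\<not> ?thesis"
  obtain w where w: "w \<in> W" using W by blast
  obtain e where e: "e \<in> E - F" using F by blast
  have "ends e \<noteq> {}" "ends e \<subseteq> V" using mg e by (auto simp: multigraph_def)
  then obtain u where u: "u \<in> ends e" "u \<in> V" by blast
  have "(adjacent E ends)\<^sup>*\<^sup>* w u" using con w u W by (auto simp: graph_connected_def)
  then have "u \<in> W"
  proof (induction rule: rtranclp_induct)
    case base
    show ?case by (rule w)
  next
    case (step y z)
    then obtain e' where e': "e' \<in> E" "ends e' = {y, z}" by (auto simp: adjacent_def)
    then have "e' \<in> F" using no step.IH by blast
    then show ?case using FW[of e'] e' by blast
  qed
  then show False using no u e by blast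
qed

context
  fixes V :: "'v set" and E :: "'e set" and ends pos \<gamma>
  assumes mg: "multigraph V E ends" and con: "graph_connected V E ends"
    and dr: "drawing V E ends pos \<gamma>"
begin

lemma edge_facts:
  assumes "e \<in> E"
  shows "arc (\<gamma> e)" "path_image (\<gamma> e) \<subseteq> S2" "{pathstart (\<gamma> e), pathfinish (\<gamma> e)} = pos ` ends e"
    "interior_pts (\<gamma> e) \<inter> pos ` V = {}" "ends e \<subseteq> V" "card (ends e) = 2"
  using assms dr mg by (auto simp: drawing_def multigraph_def)

lemma finite_graph: "finite V" "finite E"
  using mg by (auto simp: multigraph_def)

lemma pos_facts: "inj_on pos V" "pos ` V \<subseteq> S2"
  using dr by (auto simp: drawing_def)

lemma finite_edge_crossings:
  "\<lbrakk>e \<in> E; f \<in> E; e \<noteq> f\<rbrakk> \<Longrightarrow> finite (path_image (\<gamma> e) \<inter> path_image (\<gamma> f))"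
  using dr by (auto simp: drawing_def)

lemma edge_image_ends: "e \<in> E \<Longrightarrow> pos ` ends e \<subseteq> path_image (\<gamma> e)"
  using edge_facts(3)[of e] pathstart_in_path_image[of "\<gamma> e"] pathfinish_in_path_image[of "\<gamma> e"]
  by (metis empty_subsetI insert_subset)

lemma subdrawing_facts:
  assumes "F \<subseteq> E" "W \<subseteq> V"
  shows "closed (drawing_set W F pos \<gamma>)" "drawing_set W F pos \<gamma> \<subseteq> S2" "thin (drawing_set W F pos \<gamma>)"
proof -
  have fin: "finite F" "finite W" using assms finite_graph finite_subset by blast+
  have c: "closed (pos ` W)" using fin by (simp add: finite_imp_closed)
  have ce: "closed (path_image (\<gamma> e))" if "e \<in> F" for e using edge_facts(1) assms that by (auto intro: closed_arc_image)
  show "closed (drawing_set W F pos \<gamma>)"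
    unfolding drawing_set_def using c ce fin by (intro closed_Un closed_UN) auto
  show "drawing_set W F pos \<gamma> \<subseteq> S2"
    unfolding drawing_set_def using assms edge_facts(2) pos_facts(2) by blast
  have "thin (\<Union>w\<in>W. {pos w})" by (intro thin_UN fin thin_singleton closed_singleton)
  moreover have "(\<Union>w\<in>W. {pos w}) = pos ` W" by blast
  moreover have "thin (\<Union>e\<in>F. path_image (\<gamma> e))"
    using edge_facts(1) assms ce by (intro thin_UN fin thin_arc) auto
  ultimately show "thin (drawing_set W F pos \<gamma>)"
    unfolding drawing_set_def using thin_Un[OF c] by simp
qed

text \<open>Euler's inequality as an invariant: a new edge with both ends in \<open>W\<close> adds a
  representative, any other new edge adds a vertex. Only the point set has to be path-connected, so
  crossings need no separate treatment.\<close>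

lemma growing_subdrawing:
  assumes "i \<le> card E"
  shows "\<exists>F W P. F \<subseteq> E \<and> card F = i \<and> W \<subseteq> V \<and> W \<noteq> {} \<and> (\<forall>e\<in>F. ends e \<subseteq> W) \<and>
    path_connected (drawing_set W F pos \<gamma>) \<and> finite P \<and>
    separated_in (S2 - drawing_set W F pos \<gamma>) P \<and> i + 2 \<le> card P + card W"
  using assms
proof (induction i)
  case 0
  obtain v where v: "v \<in> V" using con by (auto simp: graph_connected_def)
  have "\<not> S2 \<subseteq> {pos v}"
    using thin_singleton[of "pos v"] unfolding thin_def
    by (metis openin_subtopology_self sphere_eq_empty not_one_less_zero)
  then obtain N where N: "N \<in> S2 - {pos v}" by blast
  have D: "drawing_set {v} {} pos \<gamma> = {pos v}" by (simp add: drawing_set_def)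
  \<comment> \<open>One vertex and one point off it: 0 + 2 = 1 + 1.\<close>
  show ?case
    by (rule exI[of _ "{}"], rule exI[of _ "{v}"], rule exI[of _ "{N}"])
      (use v N in \<open>simp add: D separated_in_def\<close>)
next
  case (Suc i)
  have "i \<le> card E" using Suc.prems by simp
  from Suc.IH[OF this] obtain F W P where F: "F \<subseteq> E" "card F = i" and W: "W \<subseteq> V" "W \<noteq> {}" and FW: "\<And>e. e \<in> F \<Longrightarrow> ends e \<subseteq> W"
    and pc: "path_connected (drawing_set W F pos \<gamma>)"
    and P: "finite P" "separated_in (S2 - drawing_set W F pos \<gamma>) P" "i + 2 \<le> card P + card W"
    by blast
  have "F \<noteq> E" using Suc.prems F(2) by auto
  then obtain e where e: "e \<in> E" "e \<notin> F" "ends e \<inter> W \<noteq> {}"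
    using exists_further_edge_at[OF con mg F(1) _ W FW] by blast
  let ?D = "drawing_set W F pos \<gamma>" and ?g = "path_image (\<gamma> e)"
  have D: "closed ?D" "?D \<subseteq> S2" "thin ?D" using subdrawing_facts[OF F(1) W(1)] by auto
  have D': "drawing_set (W \<union> ends e) (insert e F) pos \<gamma> = ?D \<union> ?g"
    unfolding drawing_set_def using edge_image_ends[OF e(1)] by auto
  have "?D \<inter> ?g \<noteq> {}" using e(3) edge_image_ends[OF e(1)] unfolding drawing_set_def by blast
  then have pc': "path_connected (?D \<union> ?g)"
    by (intro path_connected_Un pc path_connected_path_image arc_imp_path edge_facts(1) e(1))
  have finW: "finite W" using W(1) finite_graph(1) finite_subset by blast
  have "\<exists>P'. finite P' \<and> separated_in (S2 - (?D \<union> ?g)) P' \<and> Suc i + 2 \<le> card P' + card (W \<union> ends e)"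
  proof (cases "ends e \<subseteq> W")
    case True
    then have ends: "pathstart (\<gamma> e) \<in> ?D" "pathfinish (\<gamma> e) \<in> ?D"
      using edge_facts(3)[OF e(1)] unfolding drawing_set_def by blast+
    have "?D \<inter> ?g = (pos ` W \<inter> ?g) \<union> (\<Union>f\<in>F. path_image (\<gamma> f) \<inter> ?g)"
      unfolding drawing_set_def by blast
    moreover have "finite (\<Union>f\<in>F. path_image (\<gamma> f) \<inter> ?g)"
    proof (rule finite_UN_I)
      show "finite F" using F(1) finite_graph(2) finite_subset by blast
      show "finite (path_image (\<gamma> f) \<inter> ?g)" if "f \<in> F" for f
        using finite_edge_crossings[of f e] that e F(1) by blast
    qed
    ultimately have "finite (?D \<inter> ?g)" using finW by simp
    then obtain P' where "finite P'" "Suc (card P) \<le> card P'" "separated_in (S2 - (?D \<union> ?g)) P'"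
      using separated_in_add_arc[OF D(1) pc D(2,3) edge_facts(1,2)[OF e(1)] _ ends P(1,2)] by blast
    moreover have "W \<union> ends e = W" using True by blast
    ultimately show ?thesis using P(3) by (intro exI[of _ P']) auto
  next
    case False
    \<comment> \<open>By crossing the old drawing such an edge may split cells as well, but the gain
      of a vertex already preserves the inequality.\<close>
    obtain P' where "finite P'" "card P' = card P" "separated_in (S2 - (?D \<union> ?g)) P'"
      using separated_in_thin[OF D(1) thin_arc[OF edge_facts(1)[OF e(1)]] P(1,2)] by blast
    moreover have "card W < card (W \<union> ends e)"
      using False finW finite_subset[OF edge_facts(5)[OF e(1)] finite_graph(1)]
      by (intro psubset_card_mono) auto
    ultimately show ?thesis using P(3) by (intro exI[of _ P']) auto
  qed
  then obtain P' where P': "finite P'" "separated_in (S2 - (?D \<union> ?g)) P'" "Suc i + 2 \<le> card P' + card (W \<union> ends e)"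
    by blast
  have cF: "card (insert e F) = Suc i" using F e finite_subset[OF F(1) finite_graph(2)] by simp
  show ?case
    by (rule exI[of _ "insert e F"], rule exI[of _ "W \<union> ends e"], rule exI[of _ P'], unfold D')
      (use P' pc' cF F(1) W FW e(1) edge_facts(5)[OF e(1)] in blast)
qed

lemma many_separated_points:
  "\<exists>P. finite P \<and> separated_in (S2 - drawing_set V E pos \<gamma>) P \<and> card E + 2 \<le> card P + card V"
proof -
  obtain F W P where F: "F \<subseteq> E" "card F = card E" and W: "W \<subseteq> V"
    and P: "finite P" "separated_in (S2 - drawing_set W F pos \<gamma>) P" "card E + 2 \<le> card P + card W"
    using growing_subdrawing[OF order_refl] by blast
  have FE: "F = E" using F finite_graph(2) by (simp add: card_subset_eq)
  have "card W \<le> card V" using W finite_graph(1) by (simp add: card_mono)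
  moreover obtain P' where "finite P'" "card P' = card P"
    "separated_in (S2 - (drawing_set W F pos \<gamma> \<union> drawing_set V E pos \<gamma>)) P'"
    using separated_in_thin[OF subdrawing_facts(1)[OF F(1) W] subdrawing_facts(3)[OF order_refl order_refl] P(1,2)]
    by blast
  moreover have "drawing_set W F pos \<gamma> \<union> drawing_set V E pos \<gamma> = drawing_set V E pos \<gamma>"
    using W unfolding FE drawing_set_def by blast
  ultimately show ?thesis using P(3) by (intro exI[of _ P']) auto
qed

section \<open>Corners against degrees\<close>

lemma vertex_on_edge_iff:
  assumes "v \<in> V" "e \<in> E"
  shows "pos v \<in> path_image (\<gamma> e) \<longleftrightarrow> v \<in> ends e"
proof
  assume "pos v \<in> path_image (\<gamma> e)"
  then obtain t where t: "t \<in> {0..1}" "pos v = \<gamma> e t" by (auto simp: path_image_def)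
  have "t \<notin> {0<..<1}" using edge_facts(4)[OF assms(2)] t assms(1) unfolding interior_pts_def by blast
  then have "t = 0 \<or> t = 1" using t(1) by auto
  then have "pos v \<in> {pathstart (\<gamma> e), pathfinish (\<gamma> e)}" using t(2) by (auto simp: pathstart_def pathfinish_def)
  then have "pos v \<in> pos ` ends e" using edge_facts(3)[OF assms(2)] by simp
  then show "v \<in> ends e" using inj_onD[OF pos_facts(1)] assms(1) edge_facts(5)[OF assms(2)] by blast
qed (use edge_image_ends assms(2) in blast)

text \<open>A small enough cap sees only the edges at \<open>v\<close>, and any two of them share no
  point in it but \<open>v\<close>. An isolated vertex has one corner and degree 0, hence the
  hypothesis \<open>deg\<close>.\<close>

lemma eventually_corners_le_degree:
  assumes v: "v \<in> V" and deg: "\<exists>e\<in>E. v \<in> ends e"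
  defines "\<K> \<equiv> \<lambda>\<epsilon>. {K \<in> components (S2 \<inter> ball (pos v) \<epsilon> - drawing_set V E pos \<gamma>). pos v \<in> closure K}"
  shows "eventually (\<lambda>\<epsilon>. finite (\<K> \<epsilon>) \<and> card (\<K> \<epsilon>) \<le> card {e \<in> E. v \<in> ends e}) (at_right 0)"
proof -
  define I where "I = {e \<in> E. v \<in> ends e}"
  \<comment> \<open>Everything that the cap has to avoid: edges not at \<open>v\<close>, other
    vertices, and common points of two edges other than \<open>v\<close>. The last are finite in
    number, so removing \<open>pos v\<close> leaves a closed set.\<close>
  define B where "B = (\<Union>e\<in>E - I. path_image (\<gamma> e)) \<union> pos ` (V - {v}) \<union>
    ((\<Union>e\<in>E. \<Union>f\<in>E - {e}. path_image (\<gamma> e) \<inter> path_image (\<gamma> f)) - {pos v})"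
  have "closed B"
    unfolding B_def using finite_graph finite_edge_crossings edge_facts(1)
    by (intro closed_Un closed_UN finite_imp_closed finite_Diff finite_UN_I finite_imageI)
      (auto intro: closed_arc_image)
  moreover have "pos v \<notin> B"
    using vertex_on_edge_iff[OF v] inj_onD[OF pos_facts(1)] v unfolding B_def I_def by blast
  ultimately obtain \<epsilon>0 where \<epsilon>0: "\<epsilon>0 > 0" "ball (pos v) \<epsilon>0 \<subseteq> - B"
    by (meson ComplI open_Compl openE)
  have VB: "pos ` (V - {v}) \<subseteq> B" unfolding B_def by blast
  define \<epsilon>1 where "\<epsilon>1 = min \<epsilon>0 1"
  have "finite (\<K> \<epsilon>) \<and> card (\<K> \<epsilon>) \<le> card I" if e: "0 < \<epsilon>" "\<epsilon> < \<epsilon>1" for \<epsilon>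
  proof -
    have "ball (pos v) \<epsilon> \<subseteq> ball (pos v) \<epsilon>0" using e by (intro subset_ball) (simp add: \<epsilon>1_def)
    then have bB: "ball (pos v) \<epsilon> \<inter> B = {}" using \<epsilon>0(2) by blast
    \<comment> \<open>The edges at \<open>v\<close> are oriented away from \<open>v\<close>; they
      end at other vertices, hence outside the cap.\<close>
    define \<delta> where "\<delta> e = (if pathstart (\<gamma> e) = pos v then \<gamma> e else reversepath (\<gamma> e))" for e
    have im: "path_image (\<delta> e) = path_image (\<gamma> e)" for e by (simp add: \<delta>_def)
    have IE: "e \<in> E" "v \<in> ends e" if "e \<in> I" for e using that by (auto simp: I_def)
    have st: "pathstart (\<delta> e) = pos v" and fi: "pathfinish (\<delta> e) \<in> pos ` (V - {v})" if "e \<in> I" for e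
    proof -
      have s: "{pathstart (\<gamma> e), pathfinish (\<gamma> e)} = pos ` ends e" using edge_facts(3) IE(1)[OF that] .
      have d: "pathstart (\<gamma> e) \<noteq> pathfinish (\<gamma> e)"
        using arc_distinct_ends[OF edge_facts(1)[OF IE(1)[OF that]]] by simp
      have "pos v \<in> {pathstart (\<gamma> e), pathfinish (\<gamma> e)}" using s IE(2)[OF that] by blast
      then show 1: "pathstart (\<delta> e) = pos v" by (auto simp: \<delta>_def)
      have "pathfinish (\<delta> e) \<in> {pathstart (\<gamma> e), pathfinish (\<gamma> e)}" by (simp add: \<delta>_def)
      then obtain u where u: "u \<in> ends e" "pathfinish (\<delta> e) = pos u" using s by blast
      have "pathfinish (\<delta> e) \<noteq> pathstart (\<delta> e)" using d by (auto simp: \<delta>_def)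
      then show "pathfinish (\<delta> e) \<in> pos ` (V - {v})" using u 1 edge_facts(5)[OF IE(1)[OF that]] by force
    qed
    have eq: "S2 \<inter> ball (pos v) \<epsilon> - drawing_set V E pos \<gamma> = S2 \<inter> ball (pos v) \<epsilon> - (\<Union>e\<in>I. path_image (\<delta> e))"
    proof -
      have "x \<in> (\<Union>e\<in>I. path_image (\<gamma> e))" if x: "x \<in> ball (pos v) \<epsilon>" "x \<in> drawing_set V E pos \<gamma>" for x
      proof -
        have xB: "x \<notin> B" using x(1) bB by blast
        show ?thesis
        proof (cases "x \<in> pos ` V")
          case True
          moreover have "x \<notin> pos ` (V - {v})" using xB VB by blast
          ultimately have "x = pos v" by blast
          then show ?thesis using deg edge_image_ends unfolding I_def by blast
        next
          case False
          then obtain e where "e \<in> E" "x \<in> path_image (\<gamma> e)" using x(2) unfolding drawing_set_def by blast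
          then show ?thesis using xB unfolding B_def by blast
        qed
      qed
      moreover have "(\<Union>e\<in>I. path_image (\<gamma> e)) \<subseteq> drawing_set V E pos \<gamma>"
        unfolding drawing_set_def I_def by blast
      ultimately show ?thesis unfolding im by blast
    qed
    show ?thesis
      unfolding \<K>_def eq
    proof (rule components_at_vertex_bound)
      show "pos v \<in> S2" using pos_facts(2) v by blast
      show "0 < \<epsilon>" "\<epsilon> \<le> 1" using e by (auto simp: \<epsilon>1_def)
      show "finite I" using finite_graph by (simp add: I_def)
      show "I \<noteq> {}" using deg by (auto simp: I_def)
      show "arc (\<delta> e)" if "e \<in> I" for e
        using edge_facts(1)[OF IE(1)[OF that]] by (simp add: \<delta>_def arc_reversepath)
      show "path_image (\<delta> e) \<subseteq> S2" if "e \<in> I" for e unfolding im using edge_facts(2)[OF IE(1)[OF that]] .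
      show "pathstart (\<delta> e) = pos v" if "e \<in> I" for e using st[OF that] .
      show "pathfinish (\<delta> e) \<notin> ball (pos v) \<epsilon>" if "e \<in> I" for e
        using fi[OF that] bB VB by blast
      show "path_image (\<delta> e) \<inter> path_image (\<delta> f) \<inter> ball (pos v) \<epsilon> \<subseteq> {pos v}" if ef: "e \<in> I" "f \<in> I" "e \<noteq> f" for e f
      proof
        fix x assume x: "x \<in> path_image (\<delta> e) \<inter> path_image (\<delta> f) \<inter> ball (pos v) \<epsilon>"
        then have "x \<notin> B" using bB by blast
        moreover have "x \<in> (\<Union>e\<in>E. \<Union>f\<in>E - {e}. path_image (\<gamma> e) \<inter> path_image (\<gamma> f))"
          using x ef IE(1) unfolding im by blast
        ultimately show "x \<in> {pos v}" unfolding B_def by blast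
      qed
    qed
  qed
  moreover have "\<epsilon>1 > 0" using \<epsilon>0(1) by (simp add: \<epsilon>1_def)
  ultimately show ?thesis unfolding I_def eventually_at_right_field by blast
qed

lemma vertex_has_edge:
  assumes "v \<in> V" "card V \<ge> 2"
  shows "\<exists>e\<in>E. v \<in> ends e"
proof -
  have "V \<noteq> {v}" using assms(2) by auto
  then obtain u where u: "u \<in> V" "u \<noteq> v" using assms(1) by blast
  have "(adjacent E ends)\<^sup>*\<^sup>* v u" using con assms(1) u(1) by (auto simp: graph_connected_def)
  then obtain y where "adjacent E ends v y" using u(2) by (metis converse_rtranclpE)
  then show ?thesis by (auto simp: adjacent_def)
qed

lemma sum_degrees: "(\<Sum>v\<in>V. card {e \<in> E. v \<in> ends e}) = 2 * card E"
proof -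
  have "(\<Sum>v\<in>V. card {e \<in> E. v \<in> ends e}) = (\<Sum>v\<in>V. \<Sum>e\<in>E. if v \<in> ends e then 1 else 0)"
    using finite_graph by (intro sum.cong refl) (simp add: sum.If_cases Int_def)
  also have "\<dots> = (\<Sum>e\<in>E. \<Sum>v\<in>V. if v \<in> ends e then 1 else 0)" by (rule sum.swap)
  also have "\<dots> = (\<Sum>e\<in>E. 2)"
  proof (rule sum.cong)
    fix e assume e: "e \<in> E"
    have "V \<inter> ends e = ends e" using edge_facts(5)[OF e] by blast
    then show "(\<Sum>v\<in>V. if v \<in> ends e then 1 else 0) = (2::nat)"
      using finite_graph edge_facts(6)[OF e] by (simp add: sum.If_cases Int_def[symmetric])
  qed simp
  finally show ?thesis by simp
qed

text \<open>A corner is nonempty and lies in at most one cell, so different points of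
  \<open>P\<close> account for disjoint sets of corners at each vertex; handshaking gives the
  total.\<close>

lemma total_incidences_le:
  assumes P: "finite P" "separated_in (S2 - drawing_set V E pos \<gamma>) P"
    and K: "\<And>v. v \<in> V \<Longrightarrow> finite {K \<in> components (S2 \<inter> ball (pos v) \<epsilon> - drawing_set V E pos \<gamma>). pos v \<in> closure K} \<and>
      card {K \<in> components (S2 \<inter> ball (pos v) \<epsilon> - drawing_set V E pos \<gamma>). pos v \<in> closure K} \<le> card {e \<in> E. v \<in> ends e}"
  shows "(\<Sum>p\<in>P. vertex_incidences V E pos \<gamma> (connected_component_set (S2 - drawing_set V E pos \<gamma>) p) \<epsilon>) \<le> 2 * card E"
proof -
  let ?D = "drawing_set V E pos \<gamma>"
  let ?C = "\<lambda>p. connected_component_set (S2 - ?D) p"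
  have le: "(\<Sum>p\<in>P. corners_at V E pos \<gamma> (?C p) v \<epsilon>) \<le> card {e \<in> E. v \<in> ends e}" if v: "v \<in> V" for v
  proof -
    let ?U = "S2 \<inter> ball (pos v) \<epsilon> - ?D"
    let ?K = "{K \<in> components ?U. pos v \<in> closure K}"
    let ?Kp = "\<lambda>p. {K \<in> components ?U. K \<subseteq> ?C p \<and> pos v \<in> closure K}"
    have fin: "finite ?K" using K[OF v] by blast
    have sub: "?Kp p \<subseteq> ?K" for p by blast
    have "?Kp p \<inter> ?Kp q = {}" if pq: "p \<in> P" "q \<in> P" "p \<noteq> q" for p q
    proof -
      have "?C p \<inter> ?C q = {}"
      proof (rule ccontr)
        assume "?C p \<inter> ?C q \<noteq> {}"
        then have "connected_component (S2 - ?D) p q"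
          by (auto intro: connected_component_trans connected_component_sym)
        then show False using P(2) pq unfolding separated_in_def by blast
      qed
      then have "K = {}" if "K \<in> ?Kp p \<inter> ?Kp q" for K using that by blast
      then show ?thesis using in_components_nonempty by blast
    qed
    then have "(\<Sum>p\<in>P. card (?Kp p)) = card (\<Union>p\<in>P. ?Kp p)"
      using P(1) fin finite_subset[OF sub] by (subst card_UN_disjoint) auto
    also have "\<dots> \<le> card ?K" by (rule card_mono[OF fin]) blast
    also have "\<dots> \<le> card {e \<in> E. v \<in> ends e}" using K[OF v] by blast
    finally show ?thesis unfolding corners_at_def .
  qed
  have "(\<Sum>p\<in>P. vertex_incidences V E pos \<gamma> (?C p) \<epsilon>) = (\<Sum>v\<in>V. \<Sum>p\<in>P. corners_at V E pos \<gamma> (?C p) v \<epsilon>)"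
    unfolding vertex_incidences_def by (rule sum.swap)
  also have "\<dots> \<le> (\<Sum>v\<in>V. card {e \<in> E. v \<in> ends e})" by (rule sum_mono) (rule le)
  also have "\<dots> = 2 * card E" by (rule sum_degrees)
  finally show ?thesis .
qed

text \<open>How small the scale must be depends on the cell and on the vertex. Only the finitely
  many cells represented in \<open>P\<close> and the finitely many vertices are involved, so a
  single \<open>\<epsilon>\<close> serves for all of them.\<close>

lemma kplus_real_face_drawing_edge_bound:
  assumes n: "card V \<ge> 2" and kd: "kplus_real_face_drawing k V E ends pos \<gamma>"
  shows "k * (card E + 2) \<le> 2 * card E + k * card V"
proof -
  let ?D = "drawing_set V E pos \<gamma>"
  obtain P where P: "finite P" "separated_in (S2 - ?D) P" "card E + 2 \<le> card P + card V"
    using many_separated_points by blast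
  have "eventually (\<lambda>\<epsilon>. k \<le> vertex_incidences V E pos \<gamma> (connected_component_set (S2 - ?D) p) \<epsilon>) (at_right 0)"
    if "p \<in> P" for p
  proof -
    have "connected_component_set (S2 - ?D) p \<in> cells V E pos \<gamma>"
      unfolding cells_def using P(2) that by (auto simp: separated_in_def components_def)
    then show ?thesis using kd unfolding kplus_real_face_drawing_def by blast
  qed
  then have "eventually (\<lambda>\<epsilon>. \<forall>p\<in>P. k \<le> vertex_incidences V E pos \<gamma> (connected_component_set (S2 - ?D) p) \<epsilon>) (at_right 0)"
    using P(1) by (intro eventually_ball_finite) auto
  moreover have "eventually (\<lambda>\<epsilon>. \<forall>v\<in>V. finite {K \<in> components (S2 \<inter> ball (pos v) \<epsilon> - ?D). pos v \<in> closure K} \<and>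
      card {K \<in> components (S2 \<inter> ball (pos v) \<epsilon> - ?D). pos v \<in> closure K} \<le> card {e \<in> E. v \<in> ends e}) (at_right 0)"
    using finite_graph(1) eventually_corners_le_degree vertex_has_edge[OF _ n]
    by (intro eventually_ball_finite) auto
  ultimately have "eventually (\<lambda>\<epsilon>. (\<forall>p\<in>P. k \<le> vertex_incidences V E pos \<gamma> (connected_component_set (S2 - ?D) p) \<epsilon>) \<and>
    (\<forall>v\<in>V. finite {K \<in> components (S2 \<inter> ball (pos v) \<epsilon> - ?D). pos v \<in> closure K} \<and>
      card {K \<in> components (S2 \<inter> ball (pos v) \<epsilon> - ?D). pos v \<in> closure K} \<le> card {e \<in> E. v \<in> ends e})) (at_right 0)"
    by (rule eventually_conj)
  then obtain \<epsilon> where e1: "\<And>p. p \<in> P \<Longrightarrow> k \<le> vertex_incidences V E pos \<gamma> (connected_component_set (S2 - ?D) p) \<epsilon>"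
    and e2: "\<And>v. v \<in> V \<Longrightarrow> finite {K \<in> components (S2 \<inter> ball (pos v) \<epsilon> - ?D). pos v \<in> closure K} \<and>
      card {K \<in> components (S2 \<inter> ball (pos v) \<epsilon> - ?D). pos v \<in> closure K} \<le> card {e \<in> E. v \<in> ends e}"
    using eventually_happens[of _ "at_right (0::real)"] trivial_limit_at_right_real by blast
  have "card P * k \<le> (\<Sum>p\<in>P. vertex_incidences V E pos \<gamma> (connected_component_set (S2 - ?D) p) \<epsilon>)"
    using sum_bounded_below[of P k] e1 by simp
  also have "\<dots> \<le> 2 * card E" by (rule total_incidences_le[OF P(1,2) e2])
  finally have "k * card P \<le> 2 * card E" by (simp add: mult.commute)
  moreover have "k * (card E + 2) \<le> k * (card P + card V)" using P(3) by (rule mult_left_mono) simp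
  ultimately show ?thesis by (simp add: algebra_simps)
qed

end

theorem theorem30:
  fixes V :: "'v set" and E :: "'e set" and ends :: "'e \<Rightarrow> 'v set" and k n :: nat
  assumes "k \<ge> 3" and "n \<ge> 3"
    and "multigraph V E ends" and "card V = n"
    and "graph_connected V E ends"
    and "kplus_real_face_graph k V E ends"
  shows "real (card E) \<le> real k / (real k - 2) * (real n - 2)"
proof -
  obtain pos \<gamma> where kd: "kplus_real_face_drawing k V E ends pos \<gamma>"
    using assms(6) unfolding kplus_real_face_graph_def by blast
  then have "drawing V E ends pos \<gamma>" unfolding kplus_real_face_drawing_def by blast
  then have "k * (card E + 2) \<le> 2 * card E + k * n"
    using kplus_real_face_drawing_edge_bound[OF assms(3,5) _ _ kd] assms(2,4) by simp
  then have "real (k * (card E + 2)) \<le> real (2 * card E + k * n)" by (rule of_nat_mono)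
  then have "real (card E) * (real k - 2) \<le> real k * (real n - 2)" by (simp add: algebra_simps)
  then show ?thesis using assms(1) by (simp add: field_simps)
qed

end
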